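(* Let $G$ be a finite nonabelian solvable group. Then $G/V(G)$ is either cyclic or an elementary abelian $p$-group for some prime $p$.
   Context: For a finite group $G$, $\mathrm{Irr}(G)$ is the set of irreducible complex characters and $\mathrm{nl}(G)$ is the set of nonlinear characters (those of degree greater than $1$) in $\mathrm{Irr}(G)$. For a nonabelian finite group $G$, the vanishing-off subgroup of $G$ is $V(G)=\langle g\in G \mid \text{there exists } \chi\in\mathrm{nl}(G) \text{ such that } \chi(g)\neq 0\rangle$. It is a normal (indeed characteristic) subgroup of $G$. *)

theory Defs
  imports
    "HOL-Algebra.Solvable_Groups"
    "HOL-Algebra.Elementary_Groups"
    "HOL-Computational_Algebra.Primes"
    "Jordan_Normal_Form.VS_Connect"
begin

text \<open>Complex matrix representations of degree \<open>n\<close>: homomorphisms to the unit group of the ring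
  of complex \<open>n \<times> n\<close> matrices.\<close>

definition general_linear_group :: "nat \<Rightarrow> complex mat monoid"
  where "general_linear_group n = units_of (ring_mat TYPE(complex) n ())"

definition representation :: "('a, 'b) monoid_scheme \<Rightarrow> nat \<Rightarrow> ('a \<Rightarrow> complex mat) \<Rightarrow> bool"
  where "representation G n \<rho> \<longleftrightarrow> \<rho> \<in> hom G (general_linear_group n)"

definition invariant_subspace ::
    "('a, 'b) monoid_scheme \<Rightarrow> nat \<Rightarrow> ('a \<Rightarrow> complex mat) \<Rightarrow> complex vec set \<Rightarrow> bool"
  where "invariant_subspace G n \<rho> W \<longleftrightarrow>
    VectorSpace.subspace class_ring W (module_vec TYPE(complex) n) \<and>
    (\<forall>g\<in>carrier G. \<forall>w\<in>W. \<rho> g *\<^sub>v w \<in> W)"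

definition irreducible_representation ::
    "('a, 'b) monoid_scheme \<Rightarrow> nat \<Rightarrow> ('a \<Rightarrow> complex mat) \<Rightarrow> bool"
  where "irreducible_representation G n \<rho> \<longleftrightarrow>
    representation G n \<rho> \<and> n > 0 \<and>
    (\<forall>W. invariant_subspace G n \<rho> W \<longrightarrow> W = {0\<^sub>v n} \<or> W = carrier_vec n)"

definition trace :: "complex mat \<Rightarrow> complex"
  where "trace A = (\<Sum>i<dim_row A. A $$ (i, i))"

text \<open>Characters are restricted to the carrier, so that equal characters are equal as HOL
  functions.\<close>

definition character :: "('a, 'b) monoid_scheme \<Rightarrow> ('a \<Rightarrow> complex mat) \<Rightarrow> 'a \<Rightarrow> complex"
  where "character G \<rho> = restrict (\<lambda>g. trace (\<rho> g)) (carrier G)"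

definition Irr :: "('a, 'b) monoid_scheme \<Rightarrow> ('a \<Rightarrow> complex) set"
  where "Irr G = {character G \<rho> | n \<rho>. irreducible_representation G n \<rho>}"

text \<open>The degree of a character \<open>\<chi>\<close> is \<open>\<chi>(1)\<close>, a natural number.\<close>

definition nl :: "('a, 'b) monoid_scheme \<Rightarrow> ('a \<Rightarrow> complex) set"
  where "nl G = {\<chi> \<in> Irr G. \<exists>d::nat. \<chi> \<one>\<^bsub>G\<^esub> = of_nat d \<and> d > 1}"

definition vanishing_off :: "('a, 'b) monoid_scheme \<Rightarrow> 'a set"
  where "vanishing_off G = generate G {g \<in> carrier G. \<exists>\<chi>\<in>nl G. \<chi> g \<noteq> 0}"

definition elementary_abelian :: "nat \<Rightarrow> ('a, 'b) monoid_scheme \<Rightarrow> bool"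
  where "elementary_abelian p G \<longleftrightarrow>
    comm_group G \<and> (\<forall>x\<in>carrier G. x [^]\<^bsub>G\<^esub> p = \<one>\<^bsub>G\<^esub>)"

end

theory Submission
  imports Defs
    "Jordan_Normal_Form.DL_Rank"
    "Jordan_Normal_Form.Spectral_Radius"
    "HOL-Algebra.Multiplicative_Group"
begin

text \<open>
  Two facts about \<open>V(G)\<close> suffice. First, \<open>G' \<le> V(G)\<close>: if every nonlinear character vanished at some
  \<open>x \<in> G'\<close> with \<open>x \<noteq> 1\<close>, then only the linear constituents, each taking the value 1 at \<open>x\<close>, would
  contribute to a trace at \<open>x\<close>, so every representation would have a natural number as trace there;
  but the regular representation modulo its trivial subrepresentation has trace \<open>-1\<close>. Second, if
  \<open>x\<close> becomes central in a nonabelian quotient of \<open>G\<close>, then \<open>x \<in> V(G)\<close>: by Schur's lemma \<open>x\<close> acts as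
  a nonzero scalar in a nonlinear irreducible representation of that quotient.

  Now take a quotient \<open>H = G/K\<close> whose derived subgroup \<open>A = H'\<close> is minimal normal; \<open>A\<close> is abelian as
  \<open>G\<close> is solvable. If \<open>A\<close> is central, it has prime exponent \<open>p\<close>, and
  \<open>[x\<^sup>p, y] = [x, y]\<^sup>p = 1\<close> makes all \<open>p\<close>-th powers central. Otherwise every \<open>x\<close> outside the
  centralizer \<open>C\<close> of \<open>A\<close> acts on \<open>A\<close> without fixed points, whence \<open>C = A Z(H)\<close>; and \<open>H/C\<close> is cyclic,
  because it embeds into the multiplicative group of a finite field of endomorphisms of \<open>A\<close>.
\<close>

section \<open>Complex representations\<close>

text \<open>Invertibility is automatic: the image of the inverse of \<open>x\<close> is a two-sided
  inverse of \<open>\<rho> x\<close>.\<close>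

lemma representation_iff:
  assumes "group G"
  shows "representation G n \<rho> \<longleftrightarrow>
    (\<forall>x\<in>carrier G. \<rho> x \<in> carrier_mat n n) \<and> \<rho> \<one>\<^bsub>G\<^esub> = 1\<^sub>m n \<and>
    (\<forall>x\<in>carrier G. \<forall>y\<in>carrier G. \<rho> (x \<otimes>\<^bsub>G\<^esub> y) = \<rho> x * \<rho> y)" (is "?L \<longleftrightarrow> ?R")
proof -
  interpret group G by fact
  interpret M: ring "ring_mat TYPE(complex) n ()" by (rule ring_mat)
  have GL: "group (general_linear_group n)"
    unfolding general_linear_group_def by (rule M.units_group)
  have carrier_GL: "carrier (general_linear_group n) = Units (ring_mat TYPE(complex) n ())"
    and mult_GL: "monoid.mult (general_linear_group n) = (*)"
    and one_GL: "monoid.one (general_linear_group n) = 1\<^sub>m n"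
    by (simp_all add: general_linear_group_def units_of_def ring_mat_simps)
  show ?thesis
  proof
    assume ?L
    then have h: "\<rho> \<in> hom G (general_linear_group n)" by (simp add: representation_def)
    have "\<rho> \<one>\<^bsub>G\<^esub> = 1\<^sub>m n" using hom_one[OF h is_group GL] one_GL by simp
    moreover have "\<rho> x \<in> carrier_mat n n" if "x \<in> carrier G" for x
      using h that M.Units_closed by (auto simp: hom_def Pi_iff carrier_GL ring_mat_simps)
    ultimately show ?R using hom_mult[OF h] by (auto simp: mult_GL)
  next
    assume R: ?R
    have "\<rho> x \<in> Units (ring_mat TYPE(complex) n ())" if x: "x \<in> carrier G" for x
    proof -
      have "\<rho> (inv\<^bsub>G\<^esub> x) * \<rho> x = 1\<^sub>m n" "\<rho> x * \<rho> (inv\<^bsub>G\<^esub> x) = 1\<^sub>m n"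
        using R x by (metis inv_closed l_inv, metis inv_closed r_inv)
      then show ?thesis using R x inv_closed[OF x] unfolding Units_def ring_mat_simps by blast
    qed
    then show ?L using R
      by (auto simp: representation_def hom_def carrier_GL mult_GL)
  qed
qed

lemma invariant_subspace_iff:
  "invariant_subspace G n \<rho> W \<longleftrightarrow>
    W \<subseteq> carrier_vec n \<and> 0\<^sub>v n \<in> W \<and> (\<forall>v\<in>W. \<forall>w\<in>W. v + w \<in> W) \<and>
    (\<forall>c. \<forall>v\<in>W. c \<cdot>\<^sub>v v \<in> W) \<and> (\<forall>g\<in>carrier G. \<forall>w\<in>W. \<rho> g *\<^sub>v w \<in> W)"
proof -
  show ?thesis
    using vec_module[where ?'a = complex and n = n] vec_vs[where ?'a = complex and n = n]
    unfolding invariant_subspace_def VectorSpace.subspace_def LinearCombinations.submodule_def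
    by (auto simp: module_vec_simps class_ring_simps)
qed

section \<open>Traces, and bases adapted to a subspace\<close>

lemma trace_mult_comm:
  assumes "A \<in> carrier_mat n k" "B \<in> carrier_mat k n"
  shows "trace (A * B) = trace (B * A)"
proof -
  have "trace (A * B) = (\<Sum>i<n. \<Sum>j<k. A $$ (i, j) * B $$ (j, i))"
    using assms by (auto simp: trace_def scalar_prod_def atLeast0LessThan intro!: sum.cong)
  also have "\<dots> = (\<Sum>j<k. \<Sum>i<n. B $$ (j, i) * A $$ (i, j))"
    by (subst sum.swap) (simp add: mult.commute)
  also have "\<dots> = trace (B * A)"
    using assms by (auto simp: trace_def scalar_prod_def atLeast0LessThan intro!: sum.cong)
  finally show ?thesis .
qed

lemma trace_add:
  assumes "A \<in> carrier_mat n n" "B \<in> carrier_mat n n"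
  shows "trace (A + B) = trace A + trace B"
  using assms by (auto simp: trace_def sum.distrib)

lemma trace_one [simp]: "trace (1\<^sub>m n) = of_nat n"
  by (simp add: trace_def)

text \<open>\<open>B\<close> and \<open>C\<close> are the left and right column blocks of
  \<open>P\<close>, \<open>L\<close> and \<open>M\<close> the upper and lower row blocks of
  \<open>Q\<close>; the equations come from \<open>Q * P = 1\<close> and \<open>P * Q = 1\<close>
  read blockwise. On the span of the columns of \<open>B\<close>, \<open>L\<close> gives coordinates
  and \<open>M\<close> vanishes.\<close>

lemma block_decomposition:
  assumes P: "P \<in> carrier_mat (k + m) (k + m)"
    and Q: "(Q :: 'a :: comm_ring_1 mat) \<in> carrier_mat (k + m) (k + m)"
    and QP: "Q * P = 1\<^sub>m (k + m)" and PQ: "P * Q = 1\<^sub>m (k + m)"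
  obtains B C L M where
    "B \<in> carrier_mat (k + m) k" "C \<in> carrier_mat (k + m) m"
    "L \<in> carrier_mat k (k + m)" "M \<in> carrier_mat m (k + m)"
    "L * B = 1\<^sub>m k" "M * C = 1\<^sub>m m" "M * B = 0\<^sub>m m k" "B * L + C * M = 1\<^sub>m (k + m)"
    "\<And>j. j < k \<Longrightarrow> col B j = col P j"
proof -
  define B where "B = mat (k + m) k (\<lambda>(i, j). P $$ (i, j))"
  define C where "C = mat (k + m) m (\<lambda>(i, j). P $$ (i, k + j))"
  define L where "L = mat k (k + m) (\<lambda>(i, j). Q $$ (i, j))"
  define M where "M = mat m (k + m) (\<lambda>(i, j). Q $$ (k + i, j))"
  note defs = B_def C_def L_def M_def
  have *: "(\<Sum>t = 0..<k + m. Q $$ (i, t) * P $$ (t, j)) = (if i = j then 1 else 0)"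
    if "i < k + m" "j < k + m" for i j
    using arg_cong[OF QP, of "\<lambda>A. A $$ (i, j)"] that P Q by (simp add: scalar_prod_def)
  have **: "(\<Sum>t = 0..<k. P $$ (i, t) * Q $$ (t, j)) +
      (\<Sum>t = 0..<m. P $$ (i, k + t) * Q $$ (k + t, j)) = (if i = j then 1 else 0)"
    if "i < k + m" "j < k + m" for i j
  proof -
    have "(\<Sum>t = 0..<k. P $$ (i, t) * Q $$ (t, j)) +
      (\<Sum>t = 0..<m. P $$ (i, k + t) * Q $$ (k + t, j)) =
      (\<Sum>t = 0..<k + m. P $$ (i, t) * Q $$ (t, j))"
      using sum.atLeastLessThan_concat[of 0 k "k + m" "\<lambda>t. P $$ (i, t) * Q $$ (t, j)"]
        sum.shift_bounds_nat_ivl[of "\<lambda>t. P $$ (i, t) * Q $$ (t, j)" 0 k m]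
      by (simp add: add.commute)
    then show ?thesis
      using arg_cong[OF PQ, of "\<lambda>A. A $$ (i, j)"] that P Q by (simp add: scalar_prod_def)
  qed
  show thesis
  proof (rule that[of B C L M])
    show "L * B = 1\<^sub>m k" "M * C = 1\<^sub>m m" "M * B = 0\<^sub>m m k"
      by (rule eq_matI; auto simp: defs scalar_prod_def *)+
    show "B * L + C * M = 1\<^sub>m (k + m)"
      by (rule eq_matI) (auto simp: defs scalar_prod_def **)
    show "\<And>j. j < k \<Longrightarrow> col B j = col P j"
      using P by (auto simp: defs)
  qed (auto simp: defs)
qed

context vec_space
begin

text \<open>Independent sets have at most \<open>dim\<close> elements, so maximal ones exist:
  \<open>S\<close> is maximal inside \<open>W\<close>, and \<open>T\<close> is maximal among those
  containing \<open>S\<close>.\<close>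

lemma subspace_basis_extension:
  assumes W: "VectorSpace.subspace class_ring W V"
  obtains S T where "finite T" "S \<subseteq> T" "basis T" "span S = W"
proof -
  have Wc: "W \<subseteq> carrier_vec n"
    using W unfolding VectorSpace.subspace_def LinearCombinations.submodule_def
    by (auto simp: module_vec_simps)
  have bound: "finite A \<and> card A \<le> dim" if "A \<subseteq> carrier_vec n \<and> lin_indpt A" for A
    using that li_le_dim[OF fin_dim] by blast
  have "lin_indpt {}" unfolding lin_dep_def by auto
  then obtain S where S: "maximal S (\<lambda>A. A \<subseteq> W \<and> lin_indpt A)"
    using maximal_exists[of "\<lambda>A. A \<subseteq> W \<and> lin_indpt A" dim "{}"] bound Wc by blast
  then have SW: "S \<subseteq> W" and li: "lin_indpt S" by (auto simp: maximal_def)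
  obtain T where T: "finite T" "maximal T (\<lambda>A. S \<subseteq> A \<and> A \<subseteq> carrier_vec n \<and> lin_indpt A)"
    using maximal_exists[of "\<lambda>A. S \<subseteq> A \<and> A \<subseteq> carrier_vec n \<and> lin_indpt A" dim S] bound Wc SW li
    by blast
  \<comment> \<open>An independent set containing \<open>T\<close> also contains \<open>S\<close>,
    so \<open>T\<close> is maximal among all independent sets.\<close>
  have "maximal T (\<lambda>A. A \<subseteq> carrier_vec n \<and> lin_indpt A)"
    using T(2) unfolding maximal_def by blast
  then have basis: "basis T" using max_li_is_basis by simp
  have "w \<in> span S" if "w \<in> W" for w
  proof (rule ccontr)
    assume n: "w \<notin> span S"
    then have "w \<notin> S" using in_own_span[of S] SW Wc by auto
    then have "lin_indpt (S \<union> {w})"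
      using lin_dep_iff_in_span[of S w] n li SW Wc that by blast
    then show False using S that SW \<open>w \<notin> S\<close> unfolding maximal_def by blast
  qed
  moreover have "span S \<subseteq> W" using span_is_subset[OF SW] W
    unfolding VectorSpace.subspace_def by blast
  ultimately have "span S = W" by blast
  then show thesis using that T basis by (auto simp: maximal_def)
qed

end

text \<open>A basis of \<open>W\<close> is extended to the whole space and listed first among the
  columns of \<open>P\<close>; the four matrices are blocks of \<open>P\<close> and its
  inverse.\<close>

lemma adapted_basis:
  assumes W: "VectorSpace.subspace class_ring W (module_vec TYPE('a :: field) n)"
    and nz: "W \<noteq> {0\<^sub>v n}" and proper: "W \<noteq> carrier_vec n"
  obtains B C L M k m where "0 < k" "0 < m" "n = k + m"
    "B \<in> carrier_mat n k" "C \<in> carrier_mat n m"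
    "L \<in> carrier_mat k n" "M \<in> carrier_mat m n"
    "L * B = 1\<^sub>m k" "M * C = 1\<^sub>m m" "M * B = 0\<^sub>m m k" "B * L + C * M = 1\<^sub>m n"
    "\<And>j. j < k \<Longrightarrow> col B j \<in> W" "\<And>w. w \<in> W \<Longrightarrow> M *\<^sub>v w = 0\<^sub>v m"
proof -
  interpret V: vec_space "TYPE('a)" n .
  obtain S T where T: "finite T" "S \<subseteq> T" "V.basis T" "V.span S = W"
    using V.subspace_basis_extension[OF W] .
  have Tc: "T \<subseteq> carrier_vec n" and spT: "V.span T = carrier_vec n" and liT: "V.lin_indpt T"
    using T(3) by (auto simp: V.basis_def)
  have cardT: "card T = n" using V.dim_basis[OF T(1,3)] V.dim_is_n by simp
  have finS: "finite S" using T finite_subset by blast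
  obtain us where us: "set us = S" "distinct us" using finite_distinct_list[OF finS] by blast
  obtain vs where vs: "set vs = T - S" "distinct vs"
    using finite_distinct_list[of "T - S"] T by blast
  define k where "k = length us"
  define m where "m = length vs"
  have kc: "k = card S" and mc: "m = card (T - S)"
    using distinct_card[OF us(2)] distinct_card[OF vs(2)] us vs by (simp_all add: k_def m_def)
  have nkm: "n = k + m"
    using kc mc cardT T card_Diff_subset[OF finS, of T] card_mono[OF T(1,2)] by simp
  define P where "P = mat_of_cols n (us @ vs)"
  have Pc: "P \<in> carrier_mat n n" using nkm by (auto simp: P_def k_def m_def)
  have colsP: "cols P = us @ vs" unfolding P_def using us vs T Tc by (intro cols_mat_of_cols) auto
  have setc: "set (cols P) = T" using colsP us vs T by auto
  have "V.rank P = n"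
    using Pc liT setc by (intro V.lin_indpt_full_rank) (auto simp: colsP us vs)
  then have "det P \<noteq> 0" using V.det_rank_iff[OF Pc] by simp
  from det_non_zero_imp_unit[OF Pc this, of "()"]
  obtain Q where Q: "Q \<in> carrier_mat n n" "Q * P = 1\<^sub>m n" "P * Q = 1\<^sub>m n"
    by (auto simp: Units_def ring_mat_simps)
  from block_decomposition[of P k m Q] Pc Q nkm
  obtain B C L M where BC:
    "B \<in> carrier_mat n k" "C \<in> carrier_mat n m"
    "L \<in> carrier_mat k n" "M \<in> carrier_mat m n"
    "L * B = 1\<^sub>m k" "M * C = 1\<^sub>m m" "M * B = 0\<^sub>m m k" "B * L + C * M = 1\<^sub>m n"
    "\<And>j. j < k \<Longrightarrow> col B j = col P j" by metis
  have colB: "col B j = us ! j" if "j < k" for j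
    using BC(9)[OF that] that cols_nth[of j P] Pc nkm colsP by (simp add: nth_append k_def)
  have Sc: "S \<subseteq> carrier_vec n" using T Tc by blast
  have SW: "S \<subseteq> W" using V.in_own_span[OF Sc] T(4) by simp
  \<comment> \<open>The kernel of \<open>M\<close> is a subspace and contains \<open>S\<close>
    because \<open>M * B = 0\<close>, hence it contains the span \<open>W\<close>.\<close>
  have Mw: "M *\<^sub>v w = 0\<^sub>v m" if "w \<in> W" for w
  proof -
    let ?N = "{w \<in> carrier_vec n. M *\<^sub>v w = 0\<^sub>v m}"
    have sub: "LinearCombinations.submodule class_ring ?N (module_vec TYPE('a) n)"
      using BC(4) vec_module[where ?'a = 'a and n = n] unfolding LinearCombinations.submodule_def
      by (auto simp: module_vec_simps class_ring_simps mult_add_distrib_mat_vec mult_mat_vec)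
    have "S \<subseteq> ?N"
    proof
      fix s assume "s \<in> S"
      then obtain j where j: "j < k" "s = us ! j" using us by (metis in_set_conv_nth k_def)
      then have "M *\<^sub>v s = col (M * B) j"
        using colB BC(1,4) by (metis carrier_matD(2) col_mult2)
      then show "s \<in> ?N" using \<open>s \<in> S\<close> Sc BC(7) j by auto
    qed
    then have "V.span S \<subseteq> ?N" using V.span_is_subset sub by blast
    then show ?thesis using T that by auto
  qed
  have "k \<noteq> 0" using nz T(4) kc finS V.span_empty by auto
  moreover have "m \<noteq> 0"
  proof
    assume "m = 0"
    then have "S = T" using mc T by auto
    then show False using T spT proper by simp
  qed
  ultimately show thesis
    using that[of k m B C L M] BC nkm Mw colB SW us
    by (metis bot_nat_0.not_eq_extremum in_mono k_def nth_mem)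
qed

text \<open>In an adapted basis every \<open>\<rho> g\<close> is block upper triangular. The
  diagonal blocks are the actions on \<open>W\<close> and on the quotient by \<open>W\<close>, and
  their traces add up.\<close>

lemma reducible_split:
  assumes G: "group G" and rep: "representation G n \<rho>" and W: "invariant_subspace G n \<rho> W"
    and nz: "W \<noteq> {0\<^sub>v n}" and proper: "W \<noteq> carrier_vec n"
  obtains k m \<rho>1 \<rho>2 where "k < n" "m < n" "representation G k \<rho>1" "representation G m \<rho>2"
    "\<And>g. g \<in> carrier G \<Longrightarrow> trace (\<rho> g) = trace (\<rho>1 g) + trace (\<rho>2 g)"
proof -
  interpret group G by fact
  have sub: "VectorSpace.subspace class_ring W (module_vec TYPE(complex) n)"
    and inv: "\<And>g w. g \<in> carrier G \<Longrightarrow> w \<in> W \<Longrightarrow> \<rho> g *\<^sub>v w \<in> W"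
    using W by (auto simp: invariant_subspace_def)
  obtain B C L M k m where km: "0 < k" "0 < m" "n = k + m"
    and B: "B \<in> carrier_mat n k" and C: "C \<in> carrier_mat n m"
    and L: "L \<in> carrier_mat k n" and M: "M \<in> carrier_mat m n"
    and LB: "L * B = 1\<^sub>m k" and MC: "M * C = 1\<^sub>m m" and BLCM: "B * L + C * M = 1\<^sub>m n"
    and colB: "\<And>j. j < k \<Longrightarrow> col B j \<in> W" and MW: "\<And>w. w \<in> W \<Longrightarrow> M *\<^sub>v w = 0\<^sub>v m"
    using adapted_basis[OF sub nz proper] by metis
  have R: "\<And>g. g \<in> carrier G \<Longrightarrow> \<rho> g \<in> carrier_mat n n"
    and R1: "\<rho> \<one>\<^bsub>G\<^esub> = 1\<^sub>m n"
    and RR: "\<And>g h. g \<in> carrier G \<Longrightarrow> h \<in> carrier G \<Longrightarrow> \<rho> (g \<otimes>\<^bsub>G\<^esub> h) = \<rho> g * \<rho> h"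
    using rep unfolding representation_iff[OF G] by auto
  \<comment> \<open>The lower left block: \<open>\<rho> g\<close> keeps the columns of
    \<open>B\<close> in \<open>W\<close>, and \<open>M\<close> kills \<open>W\<close>.\<close>
  have MRB: "M * (\<rho> g * B) = 0\<^sub>m m k" if g: "g \<in> carrier G" for g
  proof (rule mat_col_eqI)
    fix j assume "j < dim_col (0\<^sub>m m k)"
    then have j: "j < k" by simp
    have "col (M * (\<rho> g * B)) j = M *\<^sub>v (\<rho> g *\<^sub>v col B j)"
      by (simp only: col_mult2[OF M mult_carrier_mat[OF R[OF g] B] j] col_mult2[OF R[OF g] B j])
    then show "col (M * (\<rho> g * B)) j = col (0\<^sub>m m k) j"
      using MW[OF inv[OF g colB[OF j]]] j by simp
  qed (use M B R[OF g] in auto)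
  \<comment> \<open>Of the two summands of \<open>B * L + C * M = 1\<close>, the second annihilates
    \<open>\<rho> g * B\<close>; this makes \<open>\<rho>1\<close> multiplicative.\<close>
  have BLX: "B * (L * (\<rho> g * B)) = \<rho> g * B" if g: "g \<in> carrier G" for g
  proof -
    have X: "\<rho> g * B \<in> carrier_mat n k" using R[OF g] B by simp
    have "\<rho> g * B = (B * L + C * M) * (\<rho> g * B)" using BLCM left_mult_one_mat[OF X] by simp
    also have "\<dots> = B * L * (\<rho> g * B) + C * M * (\<rho> g * B)"
      by (rule add_mult_distrib_mat[OF mult_carrier_mat[OF B L] mult_carrier_mat[OF C M] X])
    also have "C * M * (\<rho> g * B) = C * (M * (\<rho> g * B))"
      by (rule assoc_mult_mat[OF C M X])
    also have "\<dots> = 0\<^sub>m n k" using MRB[OF g] C by simp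
    also have "B * L * (\<rho> g * B) = B * (L * (\<rho> g * B))"
      by (rule assoc_mult_mat[OF B L X])
    finally show ?thesis using B L X by simp
  qed
  \<comment> \<open>The same argument for rows makes \<open>\<rho>2\<close> multiplicative.\<close>
  have YCM: "(M * \<rho> g) * C * M = M * \<rho> g" if g: "g \<in> carrier G" for g
  proof -
    have Y: "M * \<rho> g \<in> carrier_mat m n" using R[OF g] M by simp
    have "M * \<rho> g = (M * \<rho> g) * (B * L + C * M)" using BLCM right_mult_one_mat[OF Y] by simp
    also have "\<dots> = (M * \<rho> g) * (B * L) + (M * \<rho> g) * (C * M)"
      by (rule mult_add_distrib_mat[OF Y mult_carrier_mat[OF B L] mult_carrier_mat[OF C M]])
    also have "(M * \<rho> g) * (B * L) = (M * (\<rho> g * B)) * L"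
      by (simp add: assoc_mult_mat[OF Y B L, symmetric] assoc_mult_mat[OF M R[OF g] B])
    also have "\<dots> = 0\<^sub>m m n" using MRB[OF g] L by simp
    also have "(M * \<rho> g) * (C * M) = (M * \<rho> g) * C * M"
      by (simp add: assoc_mult_mat[OF Y C M])
    finally show ?thesis using C M Y by simp
  qed
  define \<rho>1 where "\<rho>1 g = L * (\<rho> g * B)" for g
  define \<rho>2 where "\<rho>2 g = M * \<rho> g * C" for g
  have "representation G k \<rho>1"
    unfolding representation_iff[OF G]
  proof (intro conjI ballI)
    fix g h assume g: "g \<in> carrier G" and h: "h \<in> carrier G"
    have "\<rho>1 g * \<rho>1 h = L * (\<rho> g * (B * (L * (\<rho> h * B))))"
      unfolding \<rho>1_def
      using assoc_mult_mat[OF L mult_carrier_mat[OF R[OF g] B], of "L * (\<rho> h * B)" k]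
        assoc_mult_mat[OF R[OF g] B, of "L * (\<rho> h * B)" k] R[OF h] B L by simp
    also have "\<dots> = \<rho>1 (g \<otimes>\<^bsub>G\<^esub> h)"
      by (simp add: BLX[OF h] \<rho>1_def RR[OF g h] assoc_mult_mat[OF R[OF g] R[OF h] B])
    finally show "\<rho>1 (g \<otimes>\<^bsub>G\<^esub> h) = \<rho>1 g * \<rho>1 h" by simp
  qed (use B L R R1 LB in \<open>auto simp: \<rho>1_def\<close>)
  moreover have "representation G m \<rho>2"
    unfolding representation_iff[OF G]
  proof (intro conjI ballI)
    fix g h assume g: "g \<in> carrier G" and h: "h \<in> carrier G"
    have "\<rho>2 g * \<rho>2 h = (M * \<rho> g) * C * M * (\<rho> h * C)"
      unfolding \<rho>2_def
      using assoc_mult_mat[OF mult_carrier_mat[OF mult_carrier_mat[OF M R[OF g]] C] M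
          mult_carrier_mat[OF R[OF h] C]]
        assoc_mult_mat[OF M R[OF h] C] by simp
    also have "\<dots> = \<rho>2 (g \<otimes>\<^bsub>G\<^esub> h)"
      unfolding YCM[OF g] \<rho>2_def RR[OF g h]
      by (simp add: assoc_mult_mat[OF mult_carrier_mat[OF M R[OF g]] R[OF h] C, symmetric]
        assoc_mult_mat[OF M R[OF g] R[OF h]])
    finally show "\<rho>2 (g \<otimes>\<^bsub>G\<^esub> h) = \<rho>2 g * \<rho>2 h" by simp
  qed (use C M R R1 MC in \<open>auto simp: \<rho>2_def\<close>)
  \<comment> \<open>Cyclicity of the trace moves \<open>L\<close> and \<open>M\<close> to the right,
    where \<open>B * L + C * M = 1\<close> joins the two parts.\<close>
  moreover have "trace (\<rho> g) = trace (\<rho>1 g) + trace (\<rho>2 g)" if "g \<in> carrier G" for g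
  proof -
    note Rg = R[OF that]
    have "trace (\<rho>1 g) = trace (\<rho> g * (B * L))"
      unfolding \<rho>1_def using trace_mult_comm[OF L, of "\<rho> g * B"] Rg B L by simp
    moreover have "trace (\<rho>2 g) = trace (\<rho> g * (C * M))"
      unfolding \<rho>2_def using trace_mult_comm[OF M, of "\<rho> g * C"] Rg C M by simp
    moreover have "\<rho> g * (B * L) + \<rho> g * (C * M) = \<rho> g * (B * L + C * M)"
      by (rule mult_add_distrib_mat[OF Rg mult_carrier_mat[OF B L] mult_carrier_mat[OF C M], symmetric])
    ultimately show ?thesis
      using trace_add[of "\<rho> g * (B * L)" n "\<rho> g * (C * M)"] Rg B C L M BLCM by simp
  qed
  ultimately show thesis using that[of k m \<rho>1 \<rho>2] km by simp
qed

section \<open>Nonlinear characters and the derived subgroup\<close>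

text \<open>The value of a character at the identity is the matrix size \<open>n\<close>, so the
  condition in \<open>nl\<close> becomes one on \<open>n\<close>.\<close>

lemma nl_iff:
  assumes "group G"
  shows "\<chi> \<in> nl G \<longleftrightarrow> (\<exists>n \<rho>. n > 1 \<and> irreducible_representation G n \<rho> \<and> \<chi> = character G \<rho>)"
proof -
  interpret group G by fact
  have "character G \<rho> \<one>\<^bsub>G\<^esub> = of_nat n" if "irreducible_representation G n \<rho>" for n \<rho>
    using that unfolding irreducible_representation_def representation_iff[OF assms] character_def
    by simp
  then show ?thesis unfolding nl_def Irr_def by force
qed

text \<open>Matrices of size 1 commute, so all commutators lie in the kernel of
  \<open>\<rho>\<close>.\<close>

lemma degree_one_derived:
  assumes G: "group G" and rep: "representation G 1 \<rho>" and x: "x \<in> derived G (carrier G)"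
  shows "\<rho> x = 1\<^sub>m 1"
proof -
  interpret group G by fact
  have R: "\<And>g. g \<in> carrier G \<Longrightarrow> \<rho> g \<in> carrier_mat 1 1"
    and R1: "\<rho> \<one>\<^bsub>G\<^esub> = 1\<^sub>m 1"
    and RR: "\<And>g h. g \<in> carrier G \<Longrightarrow> h \<in> carrier G \<Longrightarrow> \<rho> (g \<otimes>\<^bsub>G\<^esub> h) = \<rho> g * \<rho> h"
    using rep unfolding representation_iff[OF G] by auto
  have comm: "A * B = B * A" if "A \<in> carrier_mat 1 1" "B \<in> carrier_mat 1 1" for A B :: "complex mat"
    using that by (intro eq_matI) (auto simp: scalar_prod_def)
  let ?K = "{g \<in> carrier G. \<rho> g = 1\<^sub>m 1}"
  have "subgroup ?K G"
  proof (rule subgroupI)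
    fix g assume "g \<in> ?K"
    then have g: "g \<in> carrier G" "\<rho> g = 1\<^sub>m 1" by auto
    then have "\<rho> (inv\<^bsub>G\<^esub> g) * \<rho> g = 1\<^sub>m 1" using RR[OF inv_closed[OF g(1)] g(1)] R1 by simp
    then show "inv\<^bsub>G\<^esub> g \<in> ?K" using g R[OF inv_closed[OF g(1)]] by simp
  qed (use R1 RR in auto)
  moreover have "derived_set G (carrier G) \<subseteq> ?K"
  proof clarify
    fix g h assume g: "g \<in> carrier G" and h: "h \<in> carrier G"
    have "\<rho> (g \<otimes>\<^bsub>G\<^esub> h \<otimes>\<^bsub>G\<^esub> inv\<^bsub>G\<^esub> g \<otimes>\<^bsub>G\<^esub> inv\<^bsub>G\<^esub> h) = \<rho> (g \<otimes>\<^bsub>G\<^esub> h) * \<rho> (inv\<^bsub>G\<^esub> (h \<otimes>\<^bsub>G\<^esub> g))"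
      using g h by (simp add: RR[symmetric] m_assoc inv_mult_group)
    also have "\<rho> (g \<otimes>\<^bsub>G\<^esub> h) = \<rho> (h \<otimes>\<^bsub>G\<^esub> g)"
      using g h R by (simp add: RR comm)
    also have "\<rho> (h \<otimes>\<^bsub>G\<^esub> g) * \<rho> (inv\<^bsub>G\<^esub> (h \<otimes>\<^bsub>G\<^esub> g)) = 1\<^sub>m 1"
      using g h by (simp add: RR[symmetric] R1)
    finally show "g \<otimes>\<^bsub>G\<^esub> h \<otimes>\<^bsub>G\<^esub> inv\<^bsub>G\<^esub> g \<otimes>\<^bsub>G\<^esub> inv\<^bsub>G\<^esub> h \<in> carrier G \<and>
      \<rho> (g \<otimes>\<^bsub>G\<^esub> h \<otimes>\<^bsub>G\<^esub> inv\<^bsub>G\<^esub> g \<otimes>\<^bsub>G\<^esub> inv\<^bsub>G\<^esub> h) = 1\<^sub>m 1"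
      using g h by simp
  qed
  ultimately have "derived G (carrier G) \<subseteq> ?K"
    unfolding derived_def using generate_subgroup_incl by blast
  then show ?thesis using x by auto
qed

text \<open>Induction on the degree, splitting along invariant subspaces: at \<open>x\<close> a
  nonlinear irreducible part contributes 0 to the trace and a linear one contributes 1.\<close>

lemma trace_derived_in_Nats:
  assumes G: "group G" and x: "x \<in> derived G (carrier G)"
    and van: "\<forall>\<chi>\<in>nl G. \<chi> x = 0"
  shows "representation G n \<rho> \<Longrightarrow> trace (\<rho> x) \<in> \<nat>"
proof (induction n arbitrary: \<rho> rule: less_induct)
  case (less n)
  interpret group G by fact
  have xG: "x \<in> carrier G" using derived_in_carrier[of "carrier G"] x by auto
  \<comment> \<open>Irreducibility demands \<open>n > 0\<close>, so degree 0, where the trace is an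
    empty sum, is a case of its own.\<close>
  consider "n = 0" | "irreducible_representation G n \<rho>"
    | W where "invariant_subspace G n \<rho> W" "W \<noteq> {0\<^sub>v n}" "W \<noteq> carrier_vec n"
    using less.prems unfolding irreducible_representation_def by auto
  then show ?case
  proof cases
    case 1
    then show ?thesis
      using less.prems xG unfolding representation_iff[OF G] trace_def by auto
  next
    case 2
    show ?thesis
    proof (cases "n > 1")
      case True
      then have "character G \<rho> \<in> nl G" using 2 nl_iff[OF G] by blast
      then show ?thesis using van xG by (auto simp: character_def)
    next
      case False
      then have "n = 1" using 2 by (simp add: irreducible_representation_def)
      then have "\<rho> x = 1\<^sub>m 1" using degree_one_derived[OF G _ x] less.prems by simp
      then show ?thesis by simp
    qed
  next
    case 3
    obtain k m \<rho>1 \<rho>2 where "k < n" "m < n" "representation G k \<rho>1" "representation G m \<rho>2"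
      "\<And>g. g \<in> carrier G \<Longrightarrow> trace (\<rho> g) = trace (\<rho>1 g) + trace (\<rho>2 g)"
      using reducible_split[OF G less.prems 3] by metis
    then show ?thesis using less.IH xG by simp
  qed
qed

section \<open>The regular representation modulo the trivial one\<close>

text \<open>The regular character vanishes off the identity, and removing the trivial constituent
  subtracts 1.\<close>

lemma reduced_regular_representation:
  assumes G: "group G" and fin: "finite (carrier G)"
  obtains N \<rho> where "representation G N \<rho>"
    "\<And>x. x \<in> carrier G \<Longrightarrow> x \<noteq> \<one>\<^bsub>G\<^esub> \<Longrightarrow> trace (\<rho> x) = -1"
proof -
  interpret group G by fact
  have "card (carrier G) \<noteq> 0" using fin one_closed by auto
  then obtain N where N: "card (carrier G) = Suc N" by (cases "card (carrier G)") auto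
  obtain e where e: "bij_betw e {..N} (carrier G)"
    using ex_bij_betw_nat_finite[OF fin] N
    by (metis atLeast0LessThan lessThan_Suc_atMost)
  \<comment> \<open>\<open>e\<close> numbers the group elements from 0 to \<open>N\<close>,
    \<open>d\<close> inverts it, and \<open>p x\<close> below is left multiplication by
    \<open>x\<close> on these numbers.\<close>
  define d where "d = the_inv_into {..N} e"
  have ed: "e (d g) = g" "d g \<le> N" if "g \<in> carrier G" for g
    using that e unfolding d_def
    by (auto simp: bij_betw_def f_the_inv_into_f dest: the_inv_into_into[of e "{..N}" g "{..N}"])
  have de: "d (e j) = j" "e j \<in> carrier G" if "j \<le> N" for j
    using that e unfolding d_def by (auto simp: bij_betw_def the_inv_into_f_f)
  define p where "p x j = d (x \<otimes>\<^bsub>G\<^esub> e j)" for x j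
  have p_le: "p x j \<le> N" if "x \<in> carrier G" "j \<le> N" for x j
    using that ed de by (simp add: p_def)
  have p_mult: "p (x \<otimes>\<^bsub>G\<^esub> y) j = p x (p y j)" if "x \<in> carrier G" "y \<in> carrier G" "j \<le> N" for x y j
    using that ed de by (simp add: p_def m_assoc)
  have p_one: "p \<one>\<^bsub>G\<^esub> j = j" if "j \<le> N" for j
    using that de by (simp add: p_def)
  have p_fix: "p x j \<noteq> j" if "x \<in> carrier G" "x \<noteq> \<one>\<^bsub>G\<^esub>" "j \<le> N" for x j
  proof
    assume "p x j = j"
    then have "x \<otimes>\<^bsub>G\<^esub> e j = e j" using ed[of "x \<otimes>\<^bsub>G\<^esub> e j"] de that by (simp add: p_def)
    then show False using de that by (metis r_cancel_one)
  qed
  have p_eq: "p x k = i \<longleftrightarrow> k = p (inv\<^bsub>G\<^esub> x) i" if "x \<in> carrier G" "k \<le> N" "i \<le> N" for x k i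
    using that p_mult[of x "inv\<^bsub>G\<^esub> x" i] p_mult[of "inv\<^bsub>G\<^esub> x" x k] p_one by auto
  \<comment> \<open>The matrix of \<open>x\<close> on the regular permutation module modulo the sum of all basis vectors:
    the images of \<open>e 0, \<dots>, e (N - 1)\<close> form a basis, in which \<open>e N\<close> is minus their sum.\<close>
  define f :: "'a \<Rightarrow> nat \<Rightarrow> nat \<Rightarrow> complex"
    where "f x i k = of_bool (p x k = i) - of_bool (p x k = N)" for x i k
  have sum_delta: "(\<Sum>k\<le>N. of_bool (p x k = i)) = (1::complex)" if "x \<in> carrier G" "i \<le> N" for x i
  proof -
    have "(\<Sum>k\<le>N. of_bool (p x k = i)) = (\<Sum>k\<le>N. if k = p (inv\<^bsub>G\<^esub> x) i then 1 else (0::complex))"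
      using that by (intro sum.cong) (auto simp: p_eq)
    then show ?thesis using p_le[of "inv\<^bsub>G\<^esub> x" i] that by simp
  qed
  \<comment> \<open>Over all \<open>N + 1\<close> indices both indicators in \<open>f\<close> sum to
    1, so the term at \<open>N\<close> is minus the sum of the others.\<close>
  have sum_f: "(\<Sum>k<N. f x i k) = - f x i N" if "x \<in> carrier G" "i \<le> N" for x i
  proof -
    have "(\<Sum>k\<le>N. f x i k) = 0"
      using sum_delta[OF that] sum_delta[OF that(1), of N] by (simp add: f_def sum_subtractf)
    then show ?thesis by (simp add: lessThan_Suc_atMost[symmetric] eq_neg_iff_add_eq_0)
  qed
  define \<rho> where "\<rho> x = mat N N (\<lambda>(i, j). f x i j)" for x
  have "representation G N \<rho>"
    unfolding representation_iff[OF G]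
  proof (intro conjI ballI)
    show "\<rho> \<one>\<^bsub>G\<^esub> = 1\<^sub>m N"
      by (rule eq_matI) (auto simp: \<rho>_def f_def p_one)
    fix x y assume x: "x \<in> carrier G" and y: "y \<in> carrier G"
    have "f (x \<otimes>\<^bsub>G\<^esub> y) i j = (\<Sum>k<N. f x i k * f y k j)" if "i < N" "j < N" for i j
    proof -
      have l: "p y j \<le> N" using p_le y that by simp
      \<comment> \<open>Column \<open>j\<close> of the matrix of \<open>y\<close> is a unit vector
        if \<open>p y j < N\<close>; otherwise all its entries are -1 and \<open>sum_f\<close>
        evaluates the product.\<close>
      have "(\<Sum>k<N. f x i k * f y k j) =
        (\<Sum>k<N. if k = p y j then f x i k else 0) - of_bool (p y j = N) * (\<Sum>k<N. f x i k)"
        unfolding sum_distrib_left sum_subtractf[symmetric]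
        by (intro sum.cong) (auto simp: f_def[of y])
      also have "\<dots> = f x i (p y j)"
        using l that sum_f[OF x, of i] by auto
      also have "\<dots> = f (x \<otimes>\<^bsub>G\<^esub> y) i j"
        using that x y by (simp add: f_def p_mult)
      finally show ?thesis by simp
    qed
    then show "\<rho> (x \<otimes>\<^bsub>G\<^esub> y) = \<rho> x * \<rho> y"
      by (intro eq_matI) (auto simp: \<rho>_def scalar_prod_def atLeast0LessThan)
  qed (auto simp: \<rho>_def)
  moreover have "trace (\<rho> x) = -1" if x: "x \<in> carrier G" "x \<noteq> \<one>\<^bsub>G\<^esub>" for x
  proof -
    \<comment> \<open>\<open>p x\<close> has no fixed point, so only entries -1 remain on the
      diagonal, at the one index sent to \<open>N\<close>; it is below \<open>N\<close> because
      \<open>N\<close> is not fixed.\<close>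
    have "trace (\<rho> x) = (\<Sum>i<N. - of_bool (p x i = N))"
      using p_fix[OF x] by (auto simp: trace_def \<rho>_def f_def intro!: sum.cong)
    also have "\<dots> = - (\<Sum>i\<le>N. of_bool (p x i = N))"
      using p_fix[OF x, of N] by (simp add: lessThan_Suc_atMost[symmetric] sum_negf)
    finally show ?thesis using sum_delta[OF x(1), of N] by simp
  qed
  ultimately show thesis using that by blast
qed

text \<open>All nonlinear characters vanish outside \<open>vanishing_off G\<close>, so at a point of
  the derived subgroup outside it the trace -1 would be a natural number.\<close>

lemma derived_subset_vanishing_off:
  assumes G: "group G" and fin: "finite (carrier G)"
  shows "derived G (carrier G) \<subseteq> vanishing_off G"
proof
  interpret group G by fact
  fix x assume x: "x \<in> derived G (carrier G)"
  have xG: "x \<in> carrier G" using derived_in_carrier[of "carrier G"] x by auto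
  show "x \<in> vanishing_off G"
  proof (rule ccontr)
    assume n: "x \<notin> vanishing_off G"
    then have van: "\<forall>\<chi>\<in>nl G. \<chi> x = 0"
      using xG unfolding vanishing_off_def by (auto intro: generate.incl)
    have "x \<noteq> \<one>\<^bsub>G\<^esub>" using n generate.one[of G] unfolding vanishing_off_def by metis
    moreover obtain N \<rho> where "representation G N \<rho>"
      "\<And>x. x \<in> carrier G \<Longrightarrow> x \<noteq> \<one>\<^bsub>G\<^esub> \<Longrightarrow> trace (\<rho> x) = -1"
      using reduced_regular_representation[OF G fin] by metis
    ultimately have "(-1 :: complex) \<in> \<nat>"
      using trace_derived_in_Nats[OF G x van, of N \<rho>] xG by simp
    then obtain k :: nat where "(-1 :: complex) = of_nat k" by (auto elim: Nats_cases)
    from arg_cong[OF this, of Re] show False by simp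
  qed
qed

lemma (in group) commute_if_commutator_one:
  assumes "x \<in> carrier G" "y \<in> carrier G" "x \<otimes> y \<otimes> inv x \<otimes> inv y = \<one>"
  shows "x \<otimes> y = y \<otimes> x"
proof -
  have "x \<otimes> y \<otimes> inv (y \<otimes> x) = \<one>" using assms by (simp add: m_assoc inv_mult_group)
  then have "inv (inv (y \<otimes> x)) = x \<otimes> y" using assms by (intro inv_equality) simp_all
  then show ?thesis using assms by simp
qed

lemma (in group) derived_trivial_imp_comm_group:
  assumes "derived G (carrier G) \<subseteq> {\<one>}"
  shows "comm_group G"
proof (rule group_comm_groupI)
  fix x y assume xy: "x \<in> carrier G" "y \<in> carrier G"
  have "x \<otimes> y \<otimes> inv x \<otimes> inv y \<in> derived G (carrier G)"
    unfolding derived_def using xy by (auto intro!: generate.incl)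
  then show "x \<otimes> y = y \<otimes> x" using assms xy by (intro commute_if_commutator_one) auto
qed

text \<open>Otherwise \<open>vanishing_off G\<close> is generated by the empty set, so the derived
  subgroup inside it is trivial.\<close>

lemma ex_nl:
  assumes G: "group G" and fin: "finite (carrier G)" and nc: "\<not> comm_group G"
  shows "nl G \<noteq> {}"
proof
  assume "nl G = {}"
  then have "vanishing_off G = {\<one>\<^bsub>G\<^esub>}"
    unfolding vanishing_off_def using group.generate_empty[OF G] by simp
  then show False
    using derived_subset_vanishing_off[OF G fin] group.derived_trivial_imp_comm_group[OF G] nc by simp
qed

section \<open>Schur's lemma and central elements\<close>

text \<open>As \<open>\<phi>\<close> is onto, both groups act through the same matrices and have the
  same invariant subspaces.\<close>

lemma irreducible_representation_inflate:
  assumes G: "group G" and H: "group H" and \<phi>: "\<phi> \<in> hom G H" and surj: "\<phi> ` carrier G = carrier H"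
    and irr: "irreducible_representation H n \<rho>"
  shows "irreducible_representation G n (\<rho> \<circ> \<phi>)"
proof -
  have "representation G n (\<rho> \<circ> \<phi>)"
    using irr hom_compose[OF \<phi>] unfolding irreducible_representation_def representation_def by blast
  moreover have "invariant_subspace G n (\<rho> \<circ> \<phi>) W \<longleftrightarrow> invariant_subspace H n \<rho> W" for W
    unfolding invariant_subspace_def surj[symmetric] by auto
  ultimately show ?thesis using irr unfolding irreducible_representation_def by simp
qed

text \<open>An eigenspace of \<open>\<rho> z\<close> is invariant since \<open>z\<close> is central,
  hence is the whole space. So \<open>\<rho> z\<close> is a scalar \<open>c\<close>, nonzero by
  invertibility, with trace \<open>n * c\<close>.\<close>

lemma trace_central_nonzero:
  assumes G: "group G" and irr: "irreducible_representation G n \<rho>" and z: "z \<in> carrier G"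
    and central: "\<And>g. g \<in> carrier G \<Longrightarrow> z \<otimes>\<^bsub>G\<^esub> g = g \<otimes>\<^bsub>G\<^esub> z"
  shows "trace (\<rho> z) \<noteq> 0"
proof -
  interpret group G by fact
  have n: "n > 0" and rep: "representation G n \<rho>"
    using irr by (auto simp: irreducible_representation_def)
  have R: "\<And>g. g \<in> carrier G \<Longrightarrow> \<rho> g \<in> carrier_mat n n"
    and R1: "\<rho> \<one>\<^bsub>G\<^esub> = 1\<^sub>m n"
    and RR: "\<And>g h. g \<in> carrier G \<Longrightarrow> h \<in> carrier G \<Longrightarrow> \<rho> (g \<otimes>\<^bsub>G\<^esub> h) = \<rho> g * \<rho> h"
    using rep unfolding representation_iff[OF G] by auto
  note Rz = R[OF z]
  obtain c v where v: "v \<in> carrier_vec n" "v \<noteq> 0\<^sub>v n" "\<rho> z *\<^sub>v v = c \<cdot>\<^sub>v v"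
    using spectrum_non_empty[OF Rz n] Rz unfolding spectrum_def eigenvalue_def eigenvector_def by auto
  let ?W = "{w \<in> carrier_vec n. \<rho> z *\<^sub>v w = c \<cdot>\<^sub>v w}"
  have "invariant_subspace G n \<rho> ?W"
    unfolding invariant_subspace_iff
  proof (intro conjI ballI allI)
    fix g w assume g: "g \<in> carrier G" and w: "w \<in> ?W"
    have "\<rho> z *\<^sub>v (\<rho> g *\<^sub>v w) = (\<rho> z * \<rho> g) *\<^sub>v w"
      using w by (simp add: assoc_mult_mat_vec[OF Rz R[OF g]])
    also have "\<dots> = (\<rho> g * \<rho> z) *\<^sub>v w" using central[OF g] RR g z by metis
    also have "\<dots> = \<rho> g *\<^sub>v (c \<cdot>\<^sub>v w)" using w by (simp add: assoc_mult_mat_vec[OF R[OF g] Rz])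
    also have "\<dots> = c \<cdot>\<^sub>v (\<rho> g *\<^sub>v w)" using w R[OF g] by (simp add: mult_mat_vec)
    finally show "\<rho> g *\<^sub>v w \<in> ?W" using w R[OF g] by simp
  qed (use Rz in \<open>auto simp: mult_add_distrib_mat_vec smult_add_distrib_vec
      mult_mat_vec smult_smult_assoc mult.commute\<close>)
  then have W: "?W = carrier_vec n"
    using irr v unfolding irreducible_representation_def by blast
  have "\<rho> z $$ (i, i) = c" if i: "i < n" for i
  proof -
    have "unit_vec n i \<in> ?W" using W by simp
    then have "(\<rho> z *\<^sub>v unit_vec n i) $ i = c" using i by simp
    then show ?thesis using Rz i by (simp add: scalar_prod_right_unit)
  qed
  then have "trace (\<rho> z) = of_nat n * c" using Rz by (simp add: trace_def)
  moreover have "c \<noteq> 0"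
  proof
    assume "c = 0"
    then have "\<rho> z *\<^sub>v v = 0\<^sub>v n" using v by (auto intro!: eq_vecI)
    moreover have "\<rho> (inv\<^bsub>G\<^esub> z) *\<^sub>v (\<rho> z *\<^sub>v v) = v"
      using assoc_mult_mat_vec[OF R[OF inv_closed[OF z]] Rz v(1)] one_mult_mat_vec[OF v(1)]
        RR[OF inv_closed[OF z] z] z R1 by simp
    moreover have "\<rho> (inv\<^bsub>G\<^esub> z) *\<^sub>v 0\<^sub>v n = 0\<^sub>v n"
      using R[OF inv_closed[OF z]] by (intro eq_vecI) auto
    ultimately show False using v by simp
  qed
  ultimately show ?thesis using n by simp
qed

text \<open>A nonlinear irreducible representation of \<open>H\<close>, pulled back to
  \<open>G\<close>, has nonzero trace at \<open>x\<close>, which makes \<open>x\<close> one of the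
  generators.\<close>

lemma central_image_in_vanishing_off:
  assumes G: "group G" and H: "group H" and \<phi>: "\<phi> \<in> hom G H" and surj: "\<phi> ` carrier G = carrier H"
    and fin: "finite (carrier H)" and nc: "\<not> comm_group H" and x: "x \<in> carrier G"
    and central: "\<And>h. h \<in> carrier H \<Longrightarrow> \<phi> x \<otimes>\<^bsub>H\<^esub> h = h \<otimes>\<^bsub>H\<^esub> \<phi> x"
  shows "x \<in> vanishing_off G"
proof -
  obtain n \<rho> where n: "n > 1" and irr: "irreducible_representation H n \<rho>"
    using ex_nl[OF H fin nc] nl_iff[OF H] by blast
  let ?\<chi> = "character G (\<rho> \<circ> \<phi>)"
  have "?\<chi> \<in> nl G"
    using irreducible_representation_inflate[OF G H \<phi> surj irr] n nl_iff[OF G] by blast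
  moreover have "\<phi> x \<in> carrier H" using x surj by blast
  then have "?\<chi> x \<noteq> 0"
    using trace_central_nonzero[OF H irr _ central] x by (simp add: character_def)
  ultimately show ?thesis
    unfolding vanishing_off_def using x by (blast intro: generate.incl)
qed

section \<open>Minimal normal subgroups with abelian quotient\<close>

lemma (in group) inv_cancel_left:
  assumes "x \<in> carrier G" "y \<in> carrier G"
  shows "inv x \<otimes> (x \<otimes> y) = y" "x \<otimes> (inv x \<otimes> y) = y"
  using assms by (simp_all add: m_assoc[symmetric])

text \<open>Each of the \<open>k\<close> factors \<open>x\<close> leaves one central
  \<open>c\<close> behind on its way past \<open>y\<close>.\<close>

lemma (in group) pow_commutator:
  assumes x: "x \<in> carrier G" and y: "y \<in> carrier G" and c: "c \<in> carrier G"
    and comm: "x \<otimes> y = c \<otimes> (y \<otimes> x)" and central: "\<And>g. g \<in> carrier G \<Longrightarrow> c \<otimes> g = g \<otimes> c"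
  shows "x [^] (k :: nat) \<otimes> y = c [^] k \<otimes> (y \<otimes> x [^] k)"
proof (induction k)
  case (Suc k)
  have "x [^] Suc k \<otimes> y = (x [^] k \<otimes> c) \<otimes> (y \<otimes> x)"
    using x y c comm by (simp add: m_assoc)
  also have "\<dots> = c \<otimes> (x [^] k \<otimes> y) \<otimes> x"
    using x y c by (simp add: m_assoc central[symmetric])
  also have "\<dots> = (c \<otimes> c [^] k) \<otimes> (y \<otimes> (x [^] k \<otimes> x))"
    using x y c by (simp add: Suc.IH m_assoc)
  also have "c \<otimes> c [^] k = c [^] Suc k"
    using c central by simp
  finally show ?case by simp
qed (use assms in auto)

text \<open>The least positive power of \<open>a\<close> in \<open>S\<close> generates
  \<open>S\<close>: in a division of exponents a nonzero remainder would give a smaller one.\<close>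

lemma (in group) cyclic_subgroup_generator:
  assumes a: "a \<in> carrier G" and gen: "carrier G = {a [^] i | i :: nat. i \<in> UNIV}"
    and fin: "finite (carrier G)" and S: "subgroup S G"
  obtains s where "s \<in> S" "\<And>x. x \<in> S \<Longrightarrow> \<exists>i :: nat. x = s [^] i"
proof -
  interpret S: subgroup S G by fact
  define n where "n = (LEAST n :: nat. n > 0 \<and> a [^] n \<in> S)"
  \<comment> \<open>The power with exponent the group order is the identity, so a least exponent
    exists.\<close>
  have "Coset.order G > 0 \<and> a [^] Coset.order G \<in> S"
    using a fin by (simp add: pow_order_eq_1 order_gt_0_iff_finite)
  then have n: "n > 0" "a [^] n \<in> S"
    unfolding n_def using LeastI[of "\<lambda>n :: nat. n > 0 \<and> a [^] n \<in> S" "Coset.order G"] by simp_all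
  have "\<exists>i :: nat. x = (a [^] n) [^] i" if x: "x \<in> S" for x
  proof -
    obtain m :: nat where m: "x = a [^] m" using gen S.subset x by blast
    have qr: "x = (a [^] n) [^] (m div n) \<otimes> a [^] (m mod n)"
      using a m by (simp add: nat_pow_pow nat_pow_mult)
    then have "a [^] (m mod n) = inv ((a [^] n) [^] (m div n)) \<otimes> x"
      using a by (simp add: inv_solve_left)
    moreover have "(a [^] n) [^] k \<in> S" for k :: nat using n(2) by (induction k) auto
    ultimately have "a [^] (m mod n) \<in> S" using x by simp
    then have "m mod n = 0"
      using n(1) not_less_Least[of "m mod n" "\<lambda>n :: nat. n > 0 \<and> a [^] n \<in> S"]
      unfolding n_def[symmetric] by (metis gr0I mod_less_divisor)
    then show ?thesis using qr a by (metis nat_pow_0 nat_pow_closed r_one)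
  qed
  then show thesis using that n(2) by blast
qed

text \<open>Models the quotient \<open>H\<close> of the overview, with \<open>A\<close> its derived
  subgroup; \<open>commutator_in_A\<close> expresses without cosets that the quotient by
  \<open>A\<close> is abelian.\<close>

locale minimal_normal_with_abelian_quotient = group G for G (structure) +
  fixes A
  assumes fin: "finite (carrier G)"
    and A_normal: "A \<lhd> G"
    and A_nontrivial: "A \<noteq> {\<one>}"
    and A_comm: "a \<in> A \<Longrightarrow> b \<in> A \<Longrightarrow> a \<otimes> b = b \<otimes> a"
    and commutator_in_A: "x \<in> carrier G \<Longrightarrow> y \<in> carrier G \<Longrightarrow> x \<otimes> y \<otimes> inv x \<otimes> inv y \<in> A"
    and A_minimal: "N \<lhd> G \<Longrightarrow> N \<subseteq> A \<Longrightarrow> N = {\<one>} \<or> N = A"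
begin

sublocale A: normal A G by (rule A_normal)

lemma A_in_carrier [simp]: "a \<in> A \<Longrightarrow> a \<in> carrier G"
  using A.subset by blast

text \<open>Minimality in the form applied below to torsion subgroups, fixed point sets and kernels
  inside \<open>A\<close>.\<close>

lemma minimal_normalI:
  assumes "N \<subseteq> A" "\<one> \<in> N" "\<And>a b. a \<in> N \<Longrightarrow> b \<in> N \<Longrightarrow> a \<otimes> b \<in> N"
    "\<And>a. a \<in> N \<Longrightarrow> inv a \<in> N" "\<And>g a. g \<in> carrier G \<Longrightarrow> a \<in> N \<Longrightarrow> g \<otimes> a \<otimes> inv g \<in> N"
  shows "N = {\<one>} \<or> N = A"
proof (rule A_minimal)
  show "N \<lhd> G"
    unfolding normal_inv_iff using assms A.subset by (auto intro!: subgroupI)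
qed fact

text \<open>For a prime \<open>p\<close> dividing the order of an element of \<open>A\<close>, the
  elements of \<open>A\<close> with trivial \<open>p\<close>-th power form a nontrivial normal
  subgroup, which is \<open>A\<close> by minimality. Commutators are thus central with trivial
  \<open>p\<close>-th power, and \<open>pow_commutator\<close> applies.\<close>

lemma pow_prime_central:
  assumes central: "\<And>a g. a \<in> A \<Longrightarrow> g \<in> carrier G \<Longrightarrow> a \<otimes> g = g \<otimes> a"
  obtains p :: nat where "Factorial_Ring.prime p"
    "\<And>x y. x \<in> carrier G \<Longrightarrow> y \<in> carrier G \<Longrightarrow> x [^] p \<otimes> y = y \<otimes> x [^] p"
proof -
  obtain a where a: "a \<in> A" "a \<noteq> \<one>" using A_nontrivial A.one_closed by blast
  have "ord a \<noteq> 1" using a ord_eq_1[of a] by simp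
  then obtain p :: nat where p: "Factorial_Ring.prime p" "p dvd ord a"
    using prime_factor_nat by blast
  \<comment> \<open>\<open>b\<close> has order \<open>p\<close> and shows that the torsion subgroup
    \<open>?N\<close> is nontrivial.\<close>
  define b where "b = a [^] (ord a div p)"
  have pA: "c [^] k \<in> A" if "c \<in> A" for c and k :: nat
    using that by (induction k) auto
  have "b \<in> A" unfolding b_def using a pA by blast
  have "ord a > 0" using ord_ge_1[OF fin, of a] a by simp
  have "b \<noteq> \<one>"
  proof
    assume "b = \<one>"
    then have "ord a dvd ord a div p" using pow_eq_id[of a] a by (simp add: b_def)
    moreover have "0 < ord a div p" "ord a div p < ord a"
      using p \<open>ord a > 0\<close> prime_gt_1_nat[OF p(1)] by (auto simp: dvd_imp_le prime_gt_0_nat)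
    ultimately show False using dvd_imp_le by fastforce
  qed
  have "b [^] p = \<one>" using a p by (simp add: b_def nat_pow_pow)
  let ?N = "{a \<in> A. a [^] p = \<one>}"
  have "?N = {\<one>} \<or> ?N = A"
  proof (rule minimal_normalI)
    fix g a assume g: "g \<in> carrier G" and a: "a \<in> ?N"
    then have "g \<otimes> a \<otimes> inv g = a" using central[of a g] by (simp add: m_assoc[symmetric])
      (metis A_in_carrier inv_closed m_assoc r_inv r_one)
    then show "g \<otimes> a \<otimes> inv g \<in> ?N" using a by simp
  next
    fix a b assume "a \<in> ?N" "b \<in> ?N"
    then show "a \<otimes> b \<in> ?N" using A_comm[of a b] by (simp add: pow_mult_distrib)
  next
    fix a assume "a \<in> ?N"
    then show "inv a \<in> ?N" by (simp add: nat_pow_inv)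
  qed auto
  then have N: "?N = A" using \<open>b \<in> A\<close> \<open>b \<noteq> \<one>\<close> \<open>b [^] p = \<one>\<close> by blast
  have "x [^] p \<otimes> y = y \<otimes> x [^] p" if xy: "x \<in> carrier G" "y \<in> carrier G" for x y
  proof -
    define c where "c = x \<otimes> y \<otimes> inv x \<otimes> inv y"
    have c: "c \<in> A" unfolding c_def by (rule commutator_in_A[OF xy])
    have "x \<otimes> y = c \<otimes> (y \<otimes> x)" using xy by (simp add: c_def m_assoc inv_solve_left')
    then have "x [^] p \<otimes> y = c [^] p \<otimes> (y \<otimes> x [^] p)"
      using pow_commutator[OF xy] c central by simp
    moreover have "c [^] p = \<one>" using N c by blast
    ultimately show ?thesis using xy by simp
  qed
  then show thesis using that p by blast
qed

section \<open>The action on \<open>A\<close> by conjugation\<close>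

definition conj_by :: "'a \<Rightarrow> 'a \<Rightarrow> 'a" where "conj_by x a = x \<otimes> a \<otimes> inv x"

lemma conj_by_closed [simp]: "x \<in> carrier G \<Longrightarrow> a \<in> carrier G \<Longrightarrow> conj_by x a \<in> carrier G"
  by (simp add: conj_by_def)

lemma conj_by_in_A [simp]: "x \<in> carrier G \<Longrightarrow> a \<in> A \<Longrightarrow> conj_by x a \<in> A"
  unfolding conj_by_def by (rule A.inv_op_closed2)

lemma conj_by_conj_by:
  "x \<in> carrier G \<Longrightarrow> y \<in> carrier G \<Longrightarrow> a \<in> carrier G \<Longrightarrow> conj_by x (conj_by y a) = conj_by (x \<otimes> y) a"
  by (simp add: conj_by_def m_assoc inv_mult_group)

lemma conj_by_one [simp]: "a \<in> carrier G \<Longrightarrow> conj_by \<one> a = a" "x \<in> carrier G \<Longrightarrow> conj_by x \<one> = \<one>"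
  by (simp_all add: conj_by_def)

lemma conj_by_mult:
  "x \<in> carrier G \<Longrightarrow> a \<in> carrier G \<Longrightarrow> b \<in> carrier G \<Longrightarrow> conj_by x (a \<otimes> b) = conj_by x a \<otimes> conj_by x b"
  by (simp add: conj_by_def m_assoc inv_cancel_left)

lemma conj_by_inv: "x \<in> carrier G \<Longrightarrow> a \<in> carrier G \<Longrightarrow> conj_by x (inv a) = inv (conj_by x a)"
  by (simp add: conj_by_def m_assoc inv_mult_group)

lemma conj_by_eq_iff: "x \<in> carrier G \<Longrightarrow> a \<in> carrier G \<Longrightarrow> conj_by x a = a \<longleftrightarrow> x \<otimes> a = a \<otimes> x"
  unfolding conj_by_def by (metis inv_solve_right m_closed)

lemma conj_by_A: "a \<in> A \<Longrightarrow> b \<in> A \<Longrightarrow> conj_by a b = b"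
  by (simp add: conj_by_eq_iff A_comm)

lemma commute_mod_A:
  assumes "x \<in> carrier G" "y \<in> carrier G"
  obtains k where "k \<in> A" "x \<otimes> y = k \<otimes> (y \<otimes> x)"
  using that[OF commutator_in_A[OF assms]] assms by (simp add: m_assoc inv_solve_left')

text \<open>\<open>x \<otimes> y\<close> and \<open>y \<otimes> x\<close> differ by an element of
  \<open>A\<close>, which acts trivially because \<open>A\<close> is abelian.\<close>

lemma conj_by_commute:
  assumes x: "x \<in> carrier G" and y: "y \<in> carrier G" and a: "a \<in> A"
  shows "conj_by x (conj_by y a) = conj_by y (conj_by x a)"
proof -
  obtain k where k: "k \<in> A" "x \<otimes> y = k \<otimes> (y \<otimes> x)" using commute_mod_A[OF x y] .
  have "conj_by x (conj_by y a) = conj_by k (conj_by (y \<otimes> x) a)"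
    using x y a k by (simp add: conj_by_conj_by)
  then show ?thesis using x y a k by (simp add: conj_by_A conj_by_conj_by)
qed

text \<open>The fixed points of \<open>x\<close> in \<open>A\<close> are normalized by
  \<open>G\<close>, since conjugations commute on \<open>A\<close>; as \<open>b\<close> is moved,
  minimality leaves only the identity.\<close>

lemma fixed_point_free:
  assumes x: "x \<in> carrier G" and b: "b \<in> A" "conj_by x b \<noteq> b" and a: "a \<in> A" "conj_by x a = a"
  shows "a = \<one>"
proof -
  let ?N = "{a \<in> A. conj_by x a = a}"
  have "?N = {\<one>} \<or> ?N = A"
  proof (rule minimal_normalI)
    fix g a assume g: "g \<in> carrier G" and a: "a \<in> ?N"
    then have "conj_by x (conj_by g a) = conj_by g a" using x by (simp add: conj_by_commute)
    then show "g \<otimes> a \<otimes> inv g \<in> ?N" using a g conj_by_in_A unfolding conj_by_def by blast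
  qed (use x in \<open>auto simp: conj_by_mult conj_by_inv\<close>)
  then show ?thesis using a b by blast
qed

text \<open>A factor from \<open>A\<close> can be chosen to make \<open>c\<close> commute with
  \<open>x\<close>, and for an element centralizing \<open>A\<close>, commuting with
  \<open>x\<close> forces commuting with everything.\<close>

lemma centralizer_decomposition:
  assumes x: "x \<in> carrier G" and b: "b \<in> A" "conj_by x b \<noteq> b"
    and c: "c \<in> carrier G" "\<And>a. a \<in> A \<Longrightarrow> conj_by c a = a"
  shows "\<exists>a\<in>A. \<exists>z\<in>carrier G. c = a \<otimes> z \<and> (\<forall>g\<in>carrier G. z \<otimes> g = g \<otimes> z)"
proof -
  \<comment> \<open>\<open>f a\<close> is the commutator of \<open>a\<close> and \<open>x\<close>.
    It is injective by \<open>fixed_point_free\<close>, so by finiteness every element of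
    \<open>A\<close> is such a commutator.\<close>
  define f where "f a = a \<otimes> inv (conj_by x a)" for a
  have "inj_on f A"
  proof (rule inj_onI)
    fix a d assume a: "a \<in> A" and d: "d \<in> A" and eq: "f a = f d"
    have "f a \<otimes> conj_by x a = a" using a x by (simp add: f_def m_assoc)
    then have "f d \<otimes> conj_by x a = a" by (simp add: eq)
    then have "d \<otimes> (inv (conj_by x d) \<otimes> conj_by x a) = a"
      using a d x by (simp add: f_def m_assoc)
    then have "inv d \<otimes> a = inv (conj_by x d) \<otimes> conj_by x a"
      using a d x by (metis A_in_carrier conj_by_in_A inv_cancel_left(1) inv_closed m_closed)
    moreover have "conj_by x (inv d \<otimes> a) = inv (conj_by x d) \<otimes> conj_by x a"
      using a d x by (simp add: conj_by_mult conj_by_inv)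
    ultimately have "conj_by x (inv d \<otimes> a) = inv d \<otimes> a" by simp
    then have "inv d \<otimes> a = \<one>" using fixed_point_free[OF x b] a d by simp
    then show "a = d" using a d by (metis A_in_carrier inv_closed inv_equality inv_inv)
  qed
  moreover have "f ` A \<subseteq> A" using x by (auto simp: f_def)
  ultimately have surj: "f ` A = A"
    using endo_inj_surj finite_subset[OF A.subset fin] by blast
  define d where "d = x \<otimes> c \<otimes> inv x \<otimes> inv c"
  have d: "d \<in> A" unfolding d_def by (rule commutator_in_A[OF x c(1)])
  have xc: "conj_by x c = d \<otimes> c" using x c by (simp add: d_def conj_by_def m_assoc)
  obtain a where a: "a \<in> A" "d = f a" using surj d by blast
  have dc: "d \<otimes> c = c \<otimes> d" using c d conj_by_eq_iff[of c d] by simp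
  \<comment> \<open>The commutator of \<open>a\<close> with \<open>x\<close> cancels that of
    \<open>x\<close> with \<open>c\<close>, so \<open>x\<close> fixes \<open>z\<close>.\<close>
  define z where "z = c \<otimes> a"
  have z: "z \<in> carrier G" using c a by (simp add: z_def)
  have "conj_by x z = d \<otimes> c \<otimes> conj_by x a" using x c(1) a(1) by (simp add: z_def conj_by_mult xc)
  also have "d \<otimes> c = c \<otimes> d" by (rule dc)
  also have "c \<otimes> d \<otimes> conj_by x a = c \<otimes> (d \<otimes> conj_by x a)" using x c(1) a(1) d by (simp add: m_assoc)
  also have "d \<otimes> conj_by x a = a" using a x by (simp add: f_def m_assoc)
  finally have xz: "conj_by x z = z" by (simp add: z_def)
  have zA: "conj_by z k = k" if "k \<in> A" for k
    using that c a by (simp add: z_def conj_by_conj_by[symmetric] conj_by_A)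
  \<comment> \<open>Conjugation by \<open>x\<close> fixes \<open>z\<close> and, since
    \<open>x\<close> and \<open>g\<close> commute modulo \<open>A\<close>, also the conjugate of
    \<open>z\<close> by \<open>g\<close>. The two differ by \<open>e\<close> in \<open>A\<close>,
    which is then fixed by \<open>x\<close> and hence trivial.\<close>
  have "z \<otimes> g = g \<otimes> z" if g: "g \<in> carrier G" for g
  proof -
    obtain k where k: "k \<in> A" "x \<otimes> g = k \<otimes> (g \<otimes> x)" using commute_mod_A[OF x g] .
    define e where "e = g \<otimes> z \<otimes> inv g \<otimes> inv z"
    have e: "e \<in> A" unfolding e_def by (rule commutator_in_A[OF g z])
    have gz: "conj_by g z = e \<otimes> z" using g z by (simp add: e_def conj_by_def m_assoc)
    have "conj_by k (e \<otimes> z) = e \<otimes> conj_by k z" using k e z by (simp add: conj_by_mult conj_by_A)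
    also have "conj_by k z = z" using zA[OF k(1)] k z by (simp add: conj_by_eq_iff)
    finally have "conj_by x (conj_by g z) = conj_by g z"
      using x g z k by (simp add: conj_by_conj_by) (simp add: conj_by_conj_by[symmetric] xz gz)
    then have "conj_by x e \<otimes> z = e \<otimes> z" using x e z by (simp add: gz conj_by_mult xz)
    then have "conj_by x e = e" using x e z by simp
    then have "e = \<one>" using fixed_point_free[OF x b e] by simp
    then show ?thesis using gz g z by (simp add: conj_by_eq_iff)
  qed
  moreover have "c = inv a \<otimes> z" using c a conj_by_eq_iff[of c a] by (simp add: z_def inv_solve_left)
  ultimately show ?thesis using a z by blast
qed


section \<open>The field of central equivariant endomorphisms of \<open>A\<close>\<close>

text \<open>
  Conjugations lie in \<open>A_End\<close> because \<open>G\<close> acts on \<open>A\<close> through an abelian group, and then even in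
  its center. Passing to the center makes the division ring of Schur's lemma commutative, so
  that no appeal to Wedderburn's theorem is needed.
\<close>

definition A_End :: "('a \<Rightarrow> 'a) set" where
  "A_End = {f \<in> A \<rightarrow>\<^sub>E A. (\<forall>a\<in>A. \<forall>b\<in>A. f (a \<otimes> b) = f a \<otimes> f b) \<and>
    (\<forall>x\<in>carrier G. \<forall>a\<in>A. f (conj_by x a) = conj_by x (f a))}"

definition A_End_center :: "('a \<Rightarrow> 'a) set" where
  "A_End_center = {f \<in> A_End. \<forall>h\<in>A_End. \<forall>a\<in>A. f (h a) = h (f a)}"

text \<open>\<open>A\<close> is viewed as an additive group. Restricting all maps to
  \<open>A\<close> turns agreement on \<open>A\<close> into equality of functions.\<close>

definition A_field :: "('a \<Rightarrow> 'a) ring" where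
  "A_field = \<lparr>carrier = A_End_center, monoid.mult = (\<lambda>f h. \<lambda>a\<in>A. f (h a)), one = (\<lambda>a\<in>A. a),
    zero = (\<lambda>a\<in>A. \<one>), add = (\<lambda>f h. \<lambda>a\<in>A. f a \<otimes> h a)\<rparr>"

lemma A_field_simps [simp]:
  "carrier A_field = A_End_center"
  "monoid.mult A_field f h = (\<lambda>a\<in>A. f (h a))" "monoid.one A_field = (\<lambda>a\<in>A. a)"
  "ring.zero A_field = (\<lambda>a\<in>A. \<one>)" "ring.add A_field f h = (\<lambda>a\<in>A. f a \<otimes> h a)"
  by (simp_all add: A_field_def)

lemma A_EndD:
  assumes "f \<in> A_End"
  shows "f \<in> A \<rightarrow>\<^sub>E A" "a \<in> A \<Longrightarrow> f a \<in> A" "a \<in> A \<Longrightarrow> b \<in> A \<Longrightarrow> f (a \<otimes> b) = f a \<otimes> f b"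
    "x \<in> carrier G \<Longrightarrow> a \<in> A \<Longrightarrow> f (conj_by x a) = conj_by x (f a)"
  using assms by (auto simp: A_End_def)

lemma A_End_one [simp]: "f \<in> A_End \<Longrightarrow> f \<one> = \<one>"
  using A_EndD(3)[of f \<one> \<one>] A_EndD(2)[of f \<one>] by (simp add: l_cancel_one')

lemma A_End_inv: "f \<in> A_End \<Longrightarrow> a \<in> A \<Longrightarrow> f (inv a) = inv (f a)"
  using A_EndD(3)[of f "inv a" a] A_EndD(2)[of f a] A_EndD(2)[of f "inv a"]
  by (simp add: inv_equality)

lemma A_End_centerD:
  assumes "f \<in> A_End_center"
  shows "f \<in> A_End" "h \<in> A_End \<Longrightarrow> a \<in> A \<Longrightarrow> f (h a) = h (f a)"
  using assms by (auto simp: A_End_center_def)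

lemma A_End_eqI: "f \<in> A_End \<Longrightarrow> h \<in> A_End \<Longrightarrow> (\<And>a. a \<in> A \<Longrightarrow> f a = h a) \<Longrightarrow> f = h"
  by (meson A_EndD(1) PiE_ext)

lemma A_End_centerI:
  assumes "\<And>a. a \<in> A \<Longrightarrow> f a \<in> A" "\<And>a b. a \<in> A \<Longrightarrow> b \<in> A \<Longrightarrow> f (a \<otimes> b) = f a \<otimes> f b"
    and "\<And>x a. x \<in> carrier G \<Longrightarrow> a \<in> A \<Longrightarrow> f (conj_by x a) = conj_by x (f a)"
    and "\<And>h a. h \<in> A_End \<Longrightarrow> a \<in> A \<Longrightarrow> f (h a) = h (f a)"
  shows "(\<lambda>a\<in>A. f a) \<in> A_End_center"
  using assms by (auto simp: A_End_center_def A_End_def Pi_iff)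

lemma one_in_A_End_center: "(\<lambda>a\<in>A. a) \<in> A_End_center"
  and zero_in_A_End_center: "(\<lambda>a\<in>A. \<one>) \<in> A_End_center"
  by (rule A_End_centerI; simp add: A_EndD)+

lemma conj_by_in_A_End_center: "x \<in> carrier G \<Longrightarrow> (\<lambda>a\<in>A. conj_by x a) \<in> A_End_center"
  by (rule A_End_centerI) (auto simp: conj_by_mult conj_by_commute A_EndD)

text \<open>Schur's lemma: the kernel is normal in \<open>G\<close> by equivariance, so it is
  trivial by minimality, and injective maps on the finite \<open>A\<close> are bijective.\<close>

lemma A_End_bij:
  assumes f: "f \<in> A_End" and nz: "f \<noteq> (\<lambda>a\<in>A. \<one>)"
  shows "bij_betw f A A"
proof -
  let ?N = "{a \<in> A. f a = \<one>}"
  have "?N = {\<one>} \<or> ?N = A"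
  proof (rule minimal_normalI)
    fix g a assume "g \<in> carrier G" "a \<in> ?N"
    then have "conj_by g a \<in> ?N" using A_EndD(4)[OF f] by simp
    then show "g \<otimes> a \<otimes> inv g \<in> ?N" by (simp add: conj_by_def)
  qed (use f in \<open>auto simp: A_EndD A_End_inv\<close>)
  moreover have "?N \<noteq> A"
  proof
    assume "?N = A"
    then have "f = (\<lambda>a\<in>A. \<one>)"
      by (intro A_End_eqI[OF f A_End_centerD(1)[OF zero_in_A_End_center]]) auto
    then show False using nz by simp
  qed
  ultimately have N: "?N = {\<one>}" by simp
  have inj: "inj_on f A"
  proof (rule inj_onI)
    fix a b assume a: "a \<in> A" and b: "b \<in> A" and eq: "f a = f b"
    then have "f (a \<otimes> inv b) = \<one>" using f A_EndD(2)[OF f] by (simp add: A_EndD(3) A_End_inv)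
    then have "a \<otimes> inv b = \<one>" using N a b by blast
    then show "a = b" using a b by (metis A_in_carrier inv_closed inv_equality inv_inv)
  qed
  moreover have "f ` A = A"
    using endo_inj_surj[OF finite_subset[OF A.subset fin] _ inj] A_EndD(2)[OF f] by blast
  ultimately show ?thesis by (simp add: bij_betw_def)
qed

text \<open>The inverse map inherits every property of \<open>f\<close>: write the argument as an
  image under \<open>f\<close>, move \<open>f\<close> outside and cancel.\<close>

lemma inv_in_A_End_center:
  assumes f: "f \<in> A_End_center" and nz: "f \<noteq> (\<lambda>a\<in>A. \<one>)"
  obtains g where "g \<in> A_End_center" "\<And>a. a \<in> A \<Longrightarrow> g (f a) = a" "\<And>a. a \<in> A \<Longrightarrow> f (g a) = a"
proof -
  note fE = A_End_centerD(1)[OF f]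
  have bij: "bij_betw f A A" by (rule A_End_bij[OF fE nz])
  define g where "g = inv_into A f"
  have gA: "g a \<in> A" and fg: "f (g a) = a" if "a \<in> A" for a
    using bij that by (auto simp: g_def bij_betw_def f_inv_into_f intro!: inv_into_into)
  have gf: "g (f a) = a" if "a \<in> A" for a
    using bij that by (auto simp: g_def bij_betw_def)
  have "(\<lambda>a\<in>A. g a) \<in> A_End_center"
  proof (rule A_End_centerI)
    fix a b assume a: "a \<in> A" and b: "b \<in> A"
    have "g (a \<otimes> b) = g (f (g a \<otimes> g b))" using a b by (simp add: A_EndD(3)[OF fE] gA fg)
    then show "g (a \<otimes> b) = g a \<otimes> g b" using a b by (simp add: gf gA)
  next
    fix x a assume x: "x \<in> carrier G" and a: "a \<in> A"
    have "g (conj_by x a) = g (f (conj_by x (g a)))" using x a by (simp add: A_EndD(4)[OF fE] gA fg)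
    then show "g (conj_by x a) = conj_by x (g a)" using x a by (simp add: gf gA)
  next
    fix h a assume h: "h \<in> A_End" and a: "a \<in> A"
    have "g (h a) = g (f (h (g a)))" using h a by (simp add: A_End_centerD(2)[OF f] gA fg)
    then show "g (h a) = h (g a)" using h a by (simp add: gf gA A_EndD)
  qed (simp add: gA)
  then show thesis using that[of "\<lambda>a\<in>A. g a"] A_EndD(2)[OF fE] by (simp add: gf fg gA)
qed

text \<open>Central endomorphisms commute with each other, and nonzero ones have inverses by Schur's
  lemma.\<close>

lemma field_A_field: "field A_field"
proof -
  note D = A_EndD[OF A_End_centerD(1)] A_End_one[OF A_End_centerD(1)] A_End_inv[OF A_End_centerD(1)]
  note comm = A_End_centerD(2)[OF _ A_End_centerD(1)]
  have eqI: "(\<lambda>a\<in>A. h a) = f" if "f \<in> A_End_center" "\<And>a. a \<in> A \<Longrightarrow> h a = f a" for f h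
    using that A_EndD(1)[OF A_End_centerD(1)[OF that(1)]] by (auto simp: PiE_def extensional_def)
  have lcomm: "a \<otimes> (b \<otimes> c) = b \<otimes> (a \<otimes> c)" if "a \<in> A" "b \<in> A" "c \<in> A" for a b c
    using that A_comm[of a b] by (simp add: m_assoc[symmetric])
  have swap: "(a \<otimes> b) \<otimes> (c \<otimes> d) = (a \<otimes> c) \<otimes> (b \<otimes> d)"
    if "a \<in> A" "b \<in> A" "c \<in> A" "d \<in> A" for a b c d
    using that A_comm[of b c] by (simp add: m_assoc) (simp add: m_assoc[symmetric])
  have mult: "(\<lambda>a\<in>A. f (h a)) \<in> A_End_center" if "f \<in> A_End_center" "h \<in> A_End_center" for f h
    by (rule A_End_centerI) (use that in \<open>simp_all add: D A_End_centerD(2) A_EndD\<close>)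
  have add: "(\<lambda>a\<in>A. f a \<otimes> h a) \<in> A_End_center" if "f \<in> A_End_center" "h \<in> A_End_center" for f h
    by (rule A_End_centerI)
      (use that in \<open>simp_all add: D A_End_centerD(2) A_EndD swap conj_by_mult\<close>)
  have minus: "(\<lambda>a\<in>A. inv (f a)) \<in> A_End_center" if "f \<in> A_End_center" for f
    by (rule A_End_centerI)
      (use that in \<open>simp_all add: D A_End_centerD(2) A_EndD A_End_inv conj_by_inv inv_mult_group A_comm\<close>)
  have "cring A_field"
  proof (rule cringI)
    show "abelian_group A_field"
    proof (rule abelian_groupI)
      fix f assume f: "f \<in> carrier A_field"
      then show "\<exists>h\<in>carrier A_field. h \<oplus>\<^bsub>A_field\<^esub> f = \<zero>\<^bsub>A_field\<^esub>"
        using minus[of f] by (intro bexI[of _ "\<lambda>a\<in>A. inv (f a)"]) (auto simp: D intro!: restrict_ext)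
    qed (auto simp: add zero_in_A_End_center D m_assoc A_comm lcomm intro!: restrict_ext eqI)
    show "Group.comm_monoid A_field"
      by (rule comm_monoidI)
        (auto simp: mult one_in_A_End_center D comm intro!: restrict_ext eqI)
  qed (auto simp: D intro!: restrict_ext)
  then interpret R: cring A_field .
  have "f \<in> Units A_field \<longleftrightarrow> f \<noteq> \<zero>\<^bsub>A_field\<^esub>" if f: "f \<in> A_End_center" for f
  proof
    assume "f \<noteq> \<zero>\<^bsub>A_field\<^esub>"
    then obtain g where "g \<in> A_End_center" "\<And>a. a \<in> A \<Longrightarrow> g (f a) = a" "\<And>a. a \<in> A \<Longrightarrow> f (g a) = a"
      using inv_in_A_End_center[OF f] by auto
    then show "f \<in> Units A_field" using f by (auto simp: Units_def intro!: bexI[of _ g] restrict_ext)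
  next
    assume "f \<in> Units A_field"
    then obtain g where g: "g \<in> A_End_center" "(\<lambda>a\<in>A. g (f a)) = (\<lambda>a\<in>A. a)"
      by (auto simp: Units_def)
    obtain a where a: "a \<in> A" "a \<noteq> \<one>" using A_nontrivial A.one_closed by blast
    have "g (f a) = a" using fun_cong[OF g(2), of a] a by simp
    then have "f a \<noteq> \<one>" using a g D(5)[OF g(1)] by auto
    then show "f \<noteq> \<zero>\<^bsub>A_field\<^esub>" using a by auto
  qed
  then have "Units A_field = carrier A_field - {\<zero>\<^bsub>A_field\<^esub>}"
    by (auto simp: Units_def)
  then show ?thesis by (rule R.cring_fieldI)
qed

text \<open>Conjugation maps \<open>G\<close> into the multiplicative group of a finite field, which
  is cyclic; the image is a subgroup, hence generated by the image of a single
  \<open>g\<close>.\<close>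

lemma cyclic_action:
  "\<exists>g\<in>carrier G. \<forall>x\<in>carrier G. \<exists>i :: nat. \<forall>a\<in>A. conj_by x a = conj_by (g [^] i) a"
proof -
  interpret F: field A_field by (rule field_A_field)
  have "A_End_center \<subseteq> A \<rightarrow>\<^sub>E A" using A_EndD(1) A_End_centerD(1) by blast
  then have finF: "finite (carrier A_field)"
    using finite_PiE[of A "\<lambda>_. A"] finite_subset[OF A.subset fin] finite_subset by fastforce
  interpret M: group "mult_of A_field" by (rule F.field_mult_group)
  obtain u where u: "u \<in> carrier (mult_of A_field)"
    "carrier (mult_of A_field) = {u [^]\<^bsub>A_field\<^esub> i | i :: nat. i \<in> UNIV}"
    using F.finite_field_mult_group_has_gen[OF finF] by blast
  define \<Phi> where "\<Phi> x = (\<lambda>a\<in>A. conj_by x a)" for x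
  have nonzero: "\<Phi> x \<noteq> \<zero>\<^bsub>A_field\<^esub>" if x: "x \<in> carrier G" for x
  proof
    assume eq: "\<Phi> x = \<zero>\<^bsub>A_field\<^esub>"
    obtain a where a: "a \<in> A" "a \<noteq> \<one>" using A_nontrivial A.one_closed by blast
    have "conj_by x a = \<one>" using fun_cong[OF eq, of a] a by (simp add: \<Phi>_def)
    then have "conj_by (inv x) (conj_by x a) = \<one>" using x by simp
    then show False using x a by (simp add: conj_by_conj_by)
  qed
  have "\<Phi> \<in> hom G (mult_of A_field)"
    using nonzero conj_by_in_A_End_center
    by (auto simp: hom_def \<Phi>_def conj_by_conj_by[symmetric] intro!: restrict_ext)
  then interpret \<Phi>: group_hom G "mult_of A_field" \<Phi> by unfold_locales
  have gen: "carrier (mult_of A_field) = {u [^]\<^bsub>mult_of A_field\<^esub> i | i :: nat. i \<in> UNIV}"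
    using u(2) by (simp add: nat_pow_mult_of)
  obtain s where s: "s \<in> \<Phi> ` carrier G"
    "\<And>x. x \<in> \<Phi> ` carrier G \<Longrightarrow> \<exists>i :: nat. x = s [^]\<^bsub>mult_of A_field\<^esub> i"
    using M.cyclic_subgroup_generator[OF u(1) gen F.finite_mult_of[OF finF]
        \<Phi>.subgroup_img_is_subgroup[OF subgroup_self]] by blast
  then obtain g where g: "g \<in> carrier G" "s = \<Phi> g" by blast
  have "\<exists>i :: nat. \<forall>a\<in>A. conj_by x a = conj_by (g [^] i) a" if x: "x \<in> carrier G" for x
  proof -
    obtain i :: nat where "\<Phi> x = \<Phi> g [^]\<^bsub>mult_of A_field\<^esub> i" using s(2) x g by blast
    also have "\<dots> = \<Phi> (g [^] i)" using g by (simp add: \<Phi>.hom_nat_pow)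
    finally have "\<Phi> x a = \<Phi> (g [^] i) a" for a by simp
    then have "conj_by x a = conj_by (g [^] i) a" if "a \<in> A" for a
      using that unfolding \<Phi>_def by (metis restrict_apply')
    then show ?thesis by blast
  qed
  then show ?thesis using g(1) by blast
qed

end

section \<open>The quotient by the vanishing-off subgroup\<close>

context normal
begin

lemma group_hom_Mod: "group_hom G (G Mod H) (\<lambda>a. H #> a)"
  by (simp add: group_hom_def group_hom_axioms_def is_group factorgroup_is_group r_coset_hom_Mod)

lemma coset_eq_one_iff: "x \<in> carrier G \<Longrightarrow> H #> x = \<one>\<^bsub>G Mod H\<^esub> \<longleftrightarrow> x \<in> H"
  using coset_join1 coset_join2 is_subgroup by (metis one_FactGroup)

end

section \<open>Subgroups containing the derived subgroup\<close>

text \<open>A conjugate of \<open>v\<close> is a commutator times \<open>v\<close>.\<close>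

lemma (in group) normal_if_contains_derived:
  assumes V: "subgroup V G" and D: "derived G (carrier G) \<subseteq> V"
  shows "V \<lhd> G"
  unfolding normal_inv_iff
proof (intro conjI ballI V)
  fix g v assume g: "g \<in> carrier G" and v: "v \<in> V"
  then have vG: "v \<in> carrier G" using subgroup.subset[OF V] by blast
  have "g \<otimes> v \<otimes> inv g \<otimes> inv v \<in> V"
    using D g vG by (auto simp: derived_def intro!: generate.incl)
  then have "g \<otimes> v \<otimes> inv g \<otimes> inv v \<otimes> v \<in> V" using V v by (simp add: subgroup.m_closed)
  then show "g \<otimes> v \<otimes> inv g \<in> V" using g vG by (simp add: m_assoc)
qed

lemma (in group) comm_group_Mod_if_contains_derived:
  assumes V: "V \<lhd> G" and D: "derived G (carrier G) \<subseteq> V"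
  shows "comm_group (G Mod V)"
proof -
  interpret V: normal V G by fact
  interpret \<psi>: group_hom G "G Mod V" "\<lambda>a. V #> a" by (rule V.group_hom_Mod)
  have "derived (G Mod V) (carrier (G Mod V)) = (\<lambda>a. V #> a) ` derived G (carrier G)"
    using \<psi>.derived_img[OF order_refl] by (simp add: carrier_FactGroup)
  also have "\<dots> \<subseteq> {\<one>\<^bsub>G Mod V\<^esub>}"
  proof (rule image_subsetI)
    fix x assume "x \<in> derived G (carrier G)"
    then show "V #> x \<in> {\<one>\<^bsub>G Mod V\<^esub>}" using D V.subset V.coset_eq_one_iff by blast
  qed
  finally show ?thesis by (rule group.derived_trivial_imp_comm_group[OF V.factorgroup_is_group])
qed

section \<open>A quotient whose derived subgroup is minimal normal\<close>

text \<open>By \<open>eq\<close> the derived series is constant from its first derived term on, and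
  solvability makes it reach the trivial subgroup.\<close>

lemma (in group) solvable_derived_derived_eq_imp_trivial:
  assumes "solvable G" and eq: "derived G (derived G (carrier G)) = derived G (carrier G)"
  shows "derived G (carrier G) = {\<one>}"
proof -
  obtain n where n: "(derived G ^^ n) (carrier G) = {\<one>}"
    using assms(1) solvable_imp_trivial_derived_seq unfolding solvable_def by blast
  have "(derived G ^^ Suc k) (carrier G) = derived G (carrier G)" for k
    by (induction k) (use eq in auto)
  moreover have "(derived G ^^ Suc n) (carrier G) = derived G {\<one>}" using n by simp
  moreover have "derived G {\<one>} = {\<one>}"
    using generate_empty generate_one unfolding derived_def by simp
  ultimately show ?thesis by metis
qed

text \<open>\<open>K\<close> is chosen maximal among the normal subgroups of \<open>G\<close>
  properly inside the derived subgroup; taking preimages turns this into minimality of the image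
  \<open>A\<close>.\<close>

lemma (in group) ex_minimal_derived_quotient:
  assumes fin: "finite (carrier G)" and nc: "\<not> comm_group G" and solv: "solvable G"
  obtains K where "K \<lhd> G" "K \<subseteq> derived G (carrier G)"
    "minimal_normal_with_abelian_quotient (G Mod K) (derived (G Mod K) (carrier (G Mod K)))"
proof -
  define D where "D = derived G (carrier G)"
  have D: "D \<lhd> G" unfolding D_def by (rule derived_is_normal[OF normal_self])
  interpret D: normal D G by (rule D)
  have D1: "D \<noteq> {\<one>}" using nc derived_trivial_imp_comm_group unfolding D_def by blast
  let ?S = "{K. K \<lhd> G \<and> K \<subset> D}"
  have "?S \<subseteq> Pow (carrier G)" using D.subset by blast
  then have "finite ?S" using fin finite_subset by blast
  \<comment> \<open>The trivial subgroup qualifies because \<open>G\<close> is not abelian.\<close>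
  moreover have "{\<one>} \<in> ?S" using D1 D.one_closed one_is_normal by blast
  ultimately have "\<exists>K\<in>?S. \<forall>K'\<in>?S. K \<subseteq> K' \<longrightarrow> K = K'"
    by (intro finite_has_maximal) auto
  then obtain K where K: "K \<lhd> G" "K \<subset> D"
    and Kmax: "\<And>K'. K' \<lhd> G \<Longrightarrow> K' \<subset> D \<Longrightarrow> K \<subseteq> K' \<Longrightarrow> K = K'"
    by auto
  interpret K: normal K G by fact
  let ?\<phi> = "\<lambda>a. K #> a"
  interpret \<phi>: group_hom G "G Mod K" ?\<phi> by (rule K.group_hom_Mod)
  let ?H = "G Mod K"
  have surj: "?\<phi> ` carrier G = carrier ?H" by (simp add: carrier_FactGroup)
  have K_one: "?\<phi> x = \<one>\<^bsub>?H\<^esub>" if "x \<in> K" for x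
    using K.coset_eq_one_iff K.subset that by blast
  define A where "A = derived ?H (carrier ?H)"
  have A_img: "A = ?\<phi> ` D"
    unfolding A_def D_def using \<phi>.derived_img[OF order_refl] surj by simp
  have A_normal: "A \<lhd> ?H"
    unfolding A_def by (rule \<phi>.H.derived_is_normal[OF \<phi>.H.normal_self])
  have A_nontrivial: "A \<noteq> {\<one>\<^bsub>?H\<^esub>}"
  proof
    assume eq: "A = {\<one>\<^bsub>?H\<^esub>}"
    have "D \<subseteq> K"
    proof
      fix x assume x: "x \<in> D"
      then have "?\<phi> x = \<one>\<^bsub>?H\<^esub>" using eq A_img by blast
      then show "x \<in> K" using x D.subset K.coset_eq_one_iff by blast
    qed
    then show False using K by blast
  qed
  have A_minimal: "N = {\<one>\<^bsub>?H\<^esub>} \<or> N = A" if N: "N \<lhd> ?H" "N \<subseteq> A" for N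
  proof -
    interpret N: normal N ?H by (rule N(1))
    \<comment> \<open>The preimage of \<open>N\<close> lies between \<open>K\<close> and
      \<open>D\<close>, so by the choice of \<open>K\<close> it is one of the two.\<close>
    define K' where "K' = {x \<in> carrier G. ?\<phi> x \<in> N}"
    have "K' \<lhd> G"
      unfolding normal_inv_iff
    proof (intro conjI ballI)
      show "subgroup K' G"
      proof (rule subgroupI)
        show "K' \<noteq> {}"
          using N.one_closed unfolding K'_def
          by (metis (mono_tags, lifting) \<phi>.hom_one empty_iff mem_Collect_eq one_closed)
      qed (auto simp: K'_def simp del: mult_FactGroup)
      fix g x assume "g \<in> carrier G" "x \<in> K'"
      then show "g \<otimes> x \<otimes> inv g \<in> K'"
        using N.inv_op_closed2[of "?\<phi> g" "?\<phi> x"]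
        unfolding K'_def by (auto simp del: mult_FactGroup)
    qed
    moreover have "K' \<subseteq> D"
    proof
      fix x assume x: "x \<in> K'"
      then obtain d where d: "d \<in> D" "?\<phi> x = ?\<phi> d" using N(2) A_img unfolding K'_def by blast
      have "x \<in> K #> d" using rcos_self[of x K] K.is_subgroup x d unfolding K'_def by auto
      then show "x \<in> D" using d K(2) D.m_closed unfolding r_coset_def by blast
    qed
    moreover have "K \<subseteq> K'"
      using K_one N.one_closed K.subset unfolding K'_def by (auto simp del: one_FactGroup)
    ultimately have K': "K' = K \<or> K' = D" using Kmax[of K'] by (auto simp: psubset_eq)
    have "N \<subseteq> ?\<phi> ` carrier G" unfolding surj by (rule N.subset)
    then have N_img: "N = ?\<phi> ` K'" unfolding K'_def by auto
    show ?thesis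
    proof (rule disjE[OF K'])
      assume "K' = K"
      then have "N \<subseteq> {\<one>\<^bsub>?H\<^esub>}"
        using N_img K_one by blast
      then show ?thesis using N.one_closed by blast
    qed (use N_img A_img in simp)
  qed
  interpret A: normal A ?H by (rule A_normal)
  have "solvable ?H" using \<phi>.surj_hom_imp_solvable[OF surj solv] .
  \<comment> \<open>\<open>A\<close> is the derived subgroup of a solvable group and nontrivial, so
    its own derived subgroup is smaller; being normal, that is trivial by minimality.\<close>
  then have "derived ?H A \<noteq> A"
    using \<phi>.H.solvable_derived_derived_eq_imp_trivial A_nontrivial unfolding A_def by blast
  moreover have "derived ?H A \<subseteq> A"
    unfolding A_def by (intro \<phi>.H.mono_derived \<phi>.H.derived_in_carrier) auto
  ultimately have dA: "derived ?H A = {\<one>\<^bsub>?H\<^esub>}"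
    using A_minimal[OF \<phi>.H.derived_is_normal[OF A_normal]] by blast
  have "minimal_normal_with_abelian_quotient ?H A"
  proof (intro minimal_normal_with_abelian_quotient.intro \<phi>.H.is_group
      minimal_normal_with_abelian_quotient_axioms.intro A_normal A_nontrivial A_minimal)
    show "finite (carrier ?H)" using fin surj by (metis finite_imageI)
    fix a b assume a: "a \<in> A" and b: "b \<in> A"
    have "a \<otimes>\<^bsub>?H\<^esub> b \<otimes>\<^bsub>?H\<^esub> inv\<^bsub>?H\<^esub> a \<otimes>\<^bsub>?H\<^esub> inv\<^bsub>?H\<^esub> b \<in> derived ?H A"
      unfolding derived_def using a b by (blast intro: generate.incl)
    then show "a \<otimes>\<^bsub>?H\<^esub> b = b \<otimes>\<^bsub>?H\<^esub> a"
      using \<phi>.H.commute_if_commutator_one[of a b] a b dA A.subset by blast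
  next
    fix x y assume "x \<in> carrier ?H" "y \<in> carrier ?H"
    then show "x \<otimes>\<^bsub>?H\<^esub> y \<otimes>\<^bsub>?H\<^esub> inv\<^bsub>?H\<^esub> x \<otimes>\<^bsub>?H\<^esub> inv\<^bsub>?H\<^esub> y \<in> A"
      unfolding A_def derived_def by (blast intro: generate.incl)
  qed
  then show thesis using that[of K] K unfolding A_def D_def by blast
qed

section \<open>The elementary abelian and the cyclic case\<close>

theorem theorem1:
  fixes G :: "('a, 'b) monoid_scheme"
  assumes "group G"
    and "finite (carrier G)"
    and "\<not> comm_group G"
    and "solvable G"
  shows "cyclic_group (G Mod vanishing_off G) \<or>
    (\<exists>p::nat. Factorial_Ring.prime p \<and> elementary_abelian p (G Mod vanishing_off G))"
proof -
  interpret group G by fact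
  define V where "V = vanishing_off G"
  have D: "derived G (carrier G) \<subseteq> V"
    unfolding V_def by (rule derived_subset_vanishing_off[OF assms(1,2)])
  have "subgroup V G" unfolding V_def vanishing_off_def by (rule generate_is_subgroup) blast
  then have V: "V \<lhd> G" using D by (rule normal_if_contains_derived)
  interpret V: normal V G by (rule V)
  interpret \<psi>: group_hom G "G Mod V" "\<lambda>a. V #>\<^bsub>G\<^esub> a" by (rule V.group_hom_Mod)
  have Q_comm: "comm_group (G Mod V)" by (rule comm_group_Mod_if_contains_derived[OF V D])
  obtain K where K: "K \<lhd> G" "K \<subseteq> derived G (carrier G)"
    and min: "minimal_normal_with_abelian_quotient (G Mod K) (derived (G Mod K) (carrier (G Mod K)))"
    using ex_minimal_derived_quotient[OF assms(2-4)] .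
  interpret K: normal K G by fact
  define H where "H = G Mod K"
  define A where "A = derived H (carrier H)"
  define \<phi> where "\<phi> = (\<lambda>a. K #>\<^bsub>G\<^esub> a)"
  interpret M: minimal_normal_with_abelian_quotient H A using min unfolding H_def A_def .
  interpret \<phi>: group_hom G H \<phi> using K.group_hom_Mod unfolding H_def \<phi>_def .
  have surj: "\<phi> ` carrier G = carrier H" by (simp add: H_def \<phi>_def carrier_FactGroup)
  have A_img: "A = \<phi> ` derived G (carrier G)"
    unfolding A_def using \<phi>.derived_img[OF order_refl] surj by simp
  have "\<not> comm_group H"
    using comm_group.derived_eq_singleton[of H] M.A_nontrivial M.subgroup_self unfolding A_def by blast
  \<comment> \<open>Elements of \<open>G\<close> that become central in the nonabelian quotient
    \<open>H\<close> lie in \<open>V\<close>.\<close>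
  then have central: "x \<in> V"
    if "x \<in> carrier G" "\<And>h. h \<in> carrier H \<Longrightarrow> \<phi> x \<otimes>\<^bsub>H\<^esub> h = h \<otimes>\<^bsub>H\<^esub> \<phi> x" for x
    unfolding V_def
    using central_image_in_vanishing_off[OF assms(1) M.is_group \<phi>.homh surj M.fin _ that] by blast
  show ?thesis
    unfolding V_def[symmetric]
  proof (cases "\<forall>a\<in>A. \<forall>g\<in>carrier H. a \<otimes>\<^bsub>H\<^esub> g = g \<otimes>\<^bsub>H\<^esub> a")
    case True
    then obtain p :: nat where p: "Factorial_Ring.prime p"
      "\<And>x y. x \<in> carrier H \<Longrightarrow> y \<in> carrier H \<Longrightarrow> x [^]\<^bsub>H\<^esub> p \<otimes>\<^bsub>H\<^esub> y = y \<otimes>\<^bsub>H\<^esub> x [^]\<^bsub>H\<^esub> p"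
      using M.pow_prime_central by blast
    have "X [^]\<^bsub>G Mod V\<^esub> p = \<one>\<^bsub>G Mod V\<^esub>" if X: "X \<in> carrier (G Mod V)" for X
    proof -
      obtain x where x: "x \<in> carrier G" "X = V #>\<^bsub>G\<^esub> x" using X by (auto simp: carrier_FactGroup)
      have "x [^]\<^bsub>G\<^esub> p \<in> V" using x p(2) by (intro central) (simp_all add: \<phi>.hom_nat_pow)
      then have "V #>\<^bsub>G\<^esub> (x [^]\<^bsub>G\<^esub> p) = \<one>\<^bsub>G Mod V\<^esub>" using x V.coset_eq_one_iff by simp
      then show ?thesis using x \<psi>.hom_nat_pow by simp
    qed
    then show "cyclic_group (G Mod V) \<or>
        (\<exists>p::nat. Factorial_Ring.prime p \<and> elementary_abelian p (G Mod V))"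
      using p(1) Q_comm unfolding elementary_abelian_def by blast
  next
    \<comment> \<open>Some \<open>h\<close> moves an element \<open>b\<close> of \<open>A\<close>,
      so \<open>centralizer_decomposition\<close> applies. The coset of a preimage \<open>g'\<close>
      of \<open>g\<close>, whose powers realize the whole action on \<open>A\<close>, will generate
      the quotient by \<open>V\<close>.\<close>
    case False
    then obtain b h where h: "h \<in> carrier H" and b: "b \<in> A" "M.conj_by h b \<noteq> b"
      using M.conj_by_eq_iff by force
    obtain g where g: "g \<in> carrier H"
      "\<forall>x\<in>carrier H. \<exists>i :: nat. \<forall>a\<in>A. M.conj_by x a = M.conj_by (g [^]\<^bsub>H\<^esub> i) a"
      using M.cyclic_action by blast
    obtain g' where g': "g' \<in> carrier G" "\<phi> g' = g" using g(1) unfolding surj[symmetric] by blast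
    have powers: "\<exists>i :: nat. V #>\<^bsub>G\<^esub> x = (V #>\<^bsub>G\<^esub> g') [^]\<^bsub>G Mod V\<^esub> i" if x: "x \<in> carrier G" for x
    proof -
      have \<phi>x: "\<phi> x \<in> carrier H" using x by simp
      obtain i :: nat where i: "\<And>a. a \<in> A \<Longrightarrow> M.conj_by (\<phi> x) a = M.conj_by (g [^]\<^bsub>H\<^esub> i) a"
        using bspec[OF g(2) \<phi>x] by blast
      \<comment> \<open>\<open>c\<close> compares \<open>x\<close> with the power of
        \<open>g'\<close> acting on \<open>A\<close> in the same way, so its image centralizes
        \<open>A\<close>.\<close>
      define c where "c = inv\<^bsub>G\<^esub> (g' [^]\<^bsub>G\<^esub> i) \<otimes>\<^bsub>G\<^esub> x"
      have c: "c \<in> carrier G" using x g' by (simp add: c_def)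
      have \<phi>c: "\<phi> c = inv\<^bsub>H\<^esub> (g [^]\<^bsub>H\<^esub> i) \<otimes>\<^bsub>H\<^esub> \<phi> x"
        using x g' by (simp add: c_def \<phi>.hom_nat_pow)
      have fix_A: "M.conj_by (\<phi> c) a = a" if "a \<in> A" for a
        using that g(1) \<phi>x
        by (simp add: \<phi>c M.conj_by_conj_by[symmetric] i) (simp add: M.conj_by_conj_by)
      obtain a z where az: "a \<in> A" "z \<in> carrier H" "\<phi> c = a \<otimes>\<^bsub>H\<^esub> z"
        "\<forall>k\<in>carrier H. z \<otimes>\<^bsub>H\<^esub> k = k \<otimes>\<^bsub>H\<^esub> z"
        using M.centralizer_decomposition[OF h b \<phi>.hom_closed[OF c] fix_A] by blast
      \<comment> \<open>The factor \<open>a\<close> lifts to an element \<open>d\<close> of the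
        derived subgroup, which lies in \<open>V\<close>. What remains of \<open>c\<close> has
        central image \<open>z\<close>, so it is in \<open>V\<close> too.\<close>
      obtain d where d: "d \<in> derived G (carrier G)" "\<phi> d = a" using az(1) A_img by blast
      have dG: "d \<in> carrier G" using d derived_in_carrier[of "carrier G"] by blast
      have "\<phi> (inv\<^bsub>G\<^esub> d \<otimes>\<^bsub>G\<^esub> c) = z"
        using d dG c az by (simp add: M.inv_cancel_left)
      then have "inv\<^bsub>G\<^esub> d \<otimes>\<^bsub>G\<^esub> c \<in> V" using dG c az by (intro central) simp_all
      then have "d \<otimes>\<^bsub>G\<^esub> (inv\<^bsub>G\<^esub> d \<otimes>\<^bsub>G\<^esub> c) \<in> V" by (rule V.m_closed[OF subsetD[OF D d(1)]])
      then have "c \<in> V" using dG c by (simp add: inv_cancel_left)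
      then have Vc: "V #>\<^bsub>G\<^esub> c = \<one>\<^bsub>G Mod V\<^esub>" using c V.coset_eq_one_iff by simp
      have "x = g' [^]\<^bsub>G\<^esub> i \<otimes>\<^bsub>G\<^esub> c" using x g' by (simp add: c_def inv_cancel_left)
      then have "V #>\<^bsub>G\<^esub> x = (V #>\<^bsub>G\<^esub> (g' [^]\<^bsub>G\<^esub> i)) \<otimes>\<^bsub>G Mod V\<^esub> (V #>\<^bsub>G\<^esub> c)"
        using \<psi>.hom_mult[OF nat_pow_closed[OF g'(1)] c] by simp
      also have "\<dots> = V #>\<^bsub>G\<^esub> (g' [^]\<^bsub>G\<^esub> i)"
        unfolding Vc by (rule \<psi>.H.r_one[OF \<psi>.hom_closed[OF nat_pow_closed[OF g'(1)]]])
      also have "\<dots> = (V #>\<^bsub>G\<^esub> g') [^]\<^bsub>G Mod V\<^esub> i" by (rule \<psi>.hom_nat_pow[OF g'(1)])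
      finally show ?thesis by blast
    qed
    define y where "y = V #>\<^bsub>G\<^esub> g'"
    have y: "y \<in> carrier (G Mod V)" unfolding y_def by (rule \<psi>.hom_closed[OF g'(1)])
    \<comment> \<open>Cyclicity is stated with integer exponents; the natural ones found above
      already exhaust the carrier.\<close>
    have "carrier (G Mod V) = range (\<lambda>n::int. y [^]\<^bsub>G Mod V\<^esub> n)"
    proof
      show "carrier (G Mod V) \<subseteq> range (\<lambda>n::int. y [^]\<^bsub>G Mod V\<^esub> n)"
      proof
        fix X assume "X \<in> carrier (G Mod V)"
        then obtain x where "x \<in> carrier G" "X = V #>\<^bsub>G\<^esub> x" by (auto simp: carrier_FactGroup)
        with powers obtain i :: nat where "X = y [^]\<^bsub>G Mod V\<^esub> i" unfolding y_def by blast
        then have "X = y [^]\<^bsub>G Mod V\<^esub> int i" by (simp add: int_pow_int)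
        then show "X \<in> range (\<lambda>n::int. y [^]\<^bsub>G Mod V\<^esub> n)" by (rule range_eqI)
      qed
      show "range (\<lambda>n::int. y [^]\<^bsub>G Mod V\<^esub> n) \<subseteq> carrier (G Mod V)"
        using \<psi>.H.int_pow_closed[OF y] by auto
    qed
    then have "cyclic_group (G Mod V)" using \<psi>.H.cyclic_group y by blast
    then show "cyclic_group (G Mod V) \<or>
        (\<exists>p::nat. Factorial_Ring.prime p \<and> elementary_abelian p (G Mod V))" by simp
  qed
qed

end
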